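(* Let $X$ and $Y$ be Banach spaces, and assume that $Y$ has nontrivial type. If either (i) there exists a coarse solvent map $X\to Y$, or (ii) there exists a uniformly continuous almost uncollapsed map $X\to Y$, then $q_X\leq q_Y$.
   Context: All Banach spaces are over the reals. A Banach space $X$ has type $p\in(1,2]$ (resp. cotype $q\in[2,\infty)$) if there is $T>0$ (resp. $C>0$) such that for all $n$ and all $x_1,\dots,x_n\in X$, $\mathbb{E}_\varepsilon\|\sum_{j=1}^n\varepsilon_jx_j\|^p\le T^p\sum_{j=1}^n\|x_j\|^p$ (resp. $\mathbb{E}_\varepsilon\|\sum_{j=1}^n\varepsilon_jx_j\|^q\ge C^{-q}\sum_{j=1}^n\|x_j\|^q$), where the expectation is with respect to a uniform choice of signs $\varepsilon=(\varepsilon_j)_j\in\{-1,1\}^n$. $X$ has nontrivial type if it has type $p$ for some $p\in(1,2]$. Define $q_X=\inf\{q\in[2,\infty): X\text{ has cotype }q\}$ (with $q_X=\infty$ if $X$ has no cotype $q<\infty$). Let $f:(M,d)\to(N,\partial)$ be a map between metric spaces. Set $\omega_f(t)=\sup\{\partial(f(x),f(y)): d(x,y)\le t\}$ and $\overline{\rho}_f(t)=\inf\{\partial(f(x),f(y)): d(x,y)=t\}$ for $t\ge 0$ (with $\inf\emptyset=+\infty$). The map $f$ is coarse if $\omega_f(t)<\infty$ for all $t\ge0$; solvent if for each $n\in\mathbb{N}$ there is $R>0$ such that for all $x,y\in M$, $d(x,y)\in[R,R+n]$ implies $\partial(f(x),f(y))>n$; almost uncollapsed if $\overline{\rho}_f(t)>0$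 for some $t>0$. *)

theory Defs
  imports "HOL-Probability.Probability"
begin

text \<open>Finite families are indexed by \<open>{..<n}\<close>; a choice of signs is an extensional function
  \<open>{..<n} \<rightarrow>\<^sub>E {-1, 1}\<close>, of which there are exactly \<open>2 ^ n\<close>.\<close>

definition sign_expectation :: "nat \<Rightarrow> ((nat \<Rightarrow> real) \<Rightarrow> real) \<Rightarrow> real" where
  "sign_expectation n F = measure_pmf.expectation (pmf_of_set ({..<n} \<rightarrow>\<^sub>E {-1, 1})) F"

definition has_type :: "'a::banach itself \<Rightarrow> real \<Rightarrow> bool" where
  "has_type _ p \<longleftrightarrow> p \<in> {1<..2} \<and>
     (\<exists>T>0. \<forall>n (x :: nat \<Rightarrow> 'a).
        sign_expectation n (\<lambda>e. norm (\<Sum>j<n. e j *\<^sub>R x j) powr p)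
          \<le> T powr p * (\<Sum>j<n. norm (x j) powr p))"

definition has_cotype :: "'a::banach itself \<Rightarrow> real \<Rightarrow> bool" where
  "has_cotype _ q \<longleftrightarrow> q \<in> {2..} \<and>
     (\<exists>C>0. \<forall>n (x :: nat \<Rightarrow> 'a).
        sign_expectation n (\<lambda>e. norm (\<Sum>j<n. e j *\<^sub>R x j) powr q)
          \<ge> C powr (- q) * (\<Sum>j<n. norm (x j) powr q))"

definition has_nontrivial_type :: "'a::banach itself \<Rightarrow> bool" where
  "has_nontrivial_type X \<longleftrightarrow> (\<exists>p. has_type X p)"

text \<open>The index \<open>q\<^sub>X\<close>. The infimum is taken in \<open>ereal\<close>, so it is \<open>\<infinity>\<close> if there is no finite cotype.\<close>

definition cotype_index :: "'a::banach itself \<Rightarrow> ereal" where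
  "cotype_index X = Inf {ereal q | q. has_cotype X q}"

text \<open>The moduli \<open>\<omega>\<^sub>f\<close> and the exact compression modulus (with \<open>d(x,y) = t\<close>, not \<open>\<ge> t\<close>) of a map
  between metric spaces. They are extended-real valued; the infimum of the empty set is \<open>\<infinity>\<close>.\<close>

definition expansion_modulus :: "('a::metric_space \<Rightarrow> 'b::metric_space) \<Rightarrow> real \<Rightarrow> ereal" where
  "expansion_modulus f t = Sup {ereal (dist (f x) (f y)) | x y. dist x y \<le> t}"

definition exact_compression_modulus :: "('a::metric_space \<Rightarrow> 'b::metric_space) \<Rightarrow> real \<Rightarrow> ereal" where
  "exact_compression_modulus f t = Inf {ereal (dist (f x) (f y)) | x y. dist x y = t}"

definition coarse_map :: "('a::metric_space \<Rightarrow> 'b::metric_space) \<Rightarrow> bool" where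
  "coarse_map f \<longleftrightarrow> (\<forall>t\<ge>0. expansion_modulus f t < \<infinity>)"

definition solvent_map :: "('a::metric_space \<Rightarrow> 'b::metric_space) \<Rightarrow> bool" where
  "solvent_map f \<longleftrightarrow>
     (\<forall>n::nat. \<exists>R>0. \<forall>x y. dist x y \<in> {R..R + real n} \<longrightarrow> dist (f x) (f y) > real n)"

definition almost_uncollapsed :: "('a::metric_space \<Rightarrow> 'b::metric_space) \<Rightarrow> bool" where
  "almost_uncollapsed f \<longleftrightarrow> (\<exists>t>0. exact_compression_modulus f t > 0)"

end

theory Submission
  imports Defs "HOL-Complex_Analysis.Complex_Analysis"
begin

text \<open>
  Suppose that \<open>Y\<close> has nontrivial type and cotype \<open>q\<close>. Both hypotheses on \<open>f : X \<rightarrow> Y\<close> produce the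
  same picture at two scales: for some \<open>d, t, a > 0\<close>, points at distance at most \<open>d\<close> are moved at
  most \<open>a\<close> apart, while points at distance exactly \<open>t\<close> are moved at least \<open>8 a\<close> apart. The theorem
  \<open>cotype_transfer\<close> derives from this that \<open>X\<close> has every cotype \<open>q' > q\<close>, and the comparison of
  the two infima follows. The proof has two parts.

  The nonlinear part is the metric cotype argument of Mendel and Naor. Take vectors \<open>x\<^sub>j\<close> in \<open>X\<close>,
  among them \<open>N\<close> vectors of norm \<open>t / (2 k)\<close>, such that the random sums \<open>\<Sum>\<epsilon>\<^sub>j x\<^sub>j\<close> have bounded
  \<open>q\<close>-th moment. For every base point \<open>u\<close>, the coefficient of \<open>\<epsilon>\<^sub>j\<close> in the Walsh expansion of
  \<open>\<epsilon> \<mapsto> f (u + \<Sum>\<epsilon>\<^sub>i x\<^sub>i)\<close> is half of the increment along \<open>2 x\<^sub>j\<close> of an averaged copy of \<open>f\<close>. If the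
  Rademacher projection on \<open>Y\<close>-valued functions is bounded, then cotype \<open>q\<close> of \<open>Y\<close> bounds the sum
  over \<open>j\<close> of the \<open>q\<close>-th powers of these coefficients, uniformly in \<open>u\<close>. Summing over a box of base
  points with \<open>k\<close> steps in each direction, the increments along \<open>x\<^sub>j\<close> telescope to a displacement of
  length \<open>t\<close>, where \<open>f\<close> moves points by at least \<open>8 a\<close>. The outcome is \<open>N \<le> (k C)\<^sup>q\<close>
  (\<open>lattice_estimate\<close>). As \<open>k\<close> is free, this forces a lower estimate for the \<open>q\<close>-th moment of signed
  sums of unit vectors of \<open>X\<close>, which in turn yields cotype \<open>q'\<close> for all \<open>q' > q\<close>
  (\<open>cotype_of_equal_norm_estimate\<close>).

  The linear part is the boundedness of the Rademacher projection (\<open>rademacher_projection_bounded\<close>),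
  Pisier's theorem that nontrivial type implies K-convexity. Type excludes copies of the
  \<open>m\<close>-dimensional \<open>\<ell>\<^sub>1\<close> for large \<open>m\<close>, and this makes any product of \<open>m\<close> operators \<open>1 - E\<close>, with \<open>E\<close>
  ranging over conditional expectations on the cube, strictly smaller than \<open>2\<^sup>m\<close> in norm
  (\<open>cond_exp_product_bound\<close>). The noise operators, which multiply the Walsh functions of level \<open>j\<close>
  by \<open>x\<^sup>j\<close>, are averages of conditional expectations; so for some \<open>\<kappa> > 1\<close> the operators
  \<open>1 + \<kappa> T\<close>, \<open>T\<close> a noise operator, have uniformly bounded inverses. These control the resolvent of the
  generator on two rays, a Cauchy integral along the rays extends the semigroup to complex times
  \<open>\<alpha> + i b\<close> with \<open>0 \<le> b \<le> 2 \<pi>\<close>, and a Fourier average over \<open>b\<close> isolates level one. All bounds are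
  independent of the dimension of the cube.
\<close>

section \<open>Bounded multipliers on the levels of a cube\<close>

text \<open>
  A function \<open>g\<close> of the level acts on Walsh expansions by multiplying the terms of level \<open>k\<close> by
  \<open>g k\<close>, and \<open>B g c\<close> stands for the norm bound \<open>c\<close> of this operator. The complex analysis below uses
  only that bounded multipliers form an algebra with submultiplicative bounds, closed under pointwise
  limits on the levels \<open>0, \<dots>, n\<close> of the cube, and that it contains the noise semigroup
  \<open>k \<mapsto> x\<^sup>k\<close>, \<open>0 \<le> x \<le> 1\<close>, as contractions.
\<close>
locale level_multipliers =
  fixes n :: nat and B :: "(nat \<Rightarrow> real) \<Rightarrow> real \<Rightarrow> bool"
  assumes add: "B g c \<Longrightarrow> B h d \<Longrightarrow> B (\<lambda>k. g k + h k) (c + d)"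
    and mult: "B g c \<Longrightarrow> B h d \<Longrightarrow> B (\<lambda>k. g k * h k) (c * d)"
    and limit: "(\<And>i::nat. B (gs i) (cs i)) \<Longrightarrow> (\<And>k. k \<le> n \<Longrightarrow> (\<lambda>i. gs i k) \<longlonglongrightarrow> g k) \<Longrightarrow>
                  cs \<longlonglongrightarrow> c \<Longrightarrow> B g c"
    and const: "\<bar>a\<bar> \<le> c \<Longrightarrow> B (\<lambda>k. a) c"
    and power: "0 \<le> x \<Longrightarrow> x \<le> 1 \<Longrightarrow> B (\<lambda>k. x ^ k) 1"
begin

lemma mono: "B g c \<Longrightarrow> c \<le> d \<Longrightarrow> B g d"
  using add[of g c "\<lambda>k. 0" "d - c"] const[of 0 "d - c"] by simp

lemma cong: "B g c \<Longrightarrow> (\<And>k. k \<le> n \<Longrightarrow> g k = h k) \<Longrightarrow> B h c"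
  by (rule limit[of "\<lambda>_. g" "\<lambda>_. c"]) auto

lemma scale: "B g c \<Longrightarrow> B (\<lambda>k. a * g k) (\<bar>a\<bar> * c)"
  using mult[OF const[OF order_refl]] by blast

lemma finite_sum:
  "finite S \<Longrightarrow> (\<And>i. i \<in> S \<Longrightarrow> B (g i) (c i)) \<Longrightarrow> B (\<lambda>k. \<Sum>i\<in>S. g i k) (\<Sum>i\<in>S. c i)"
proof (induction S rule: finite_induct)
  case empty
  then show ?case using const[of 0 0] by simp
next
  case (insert x F)
  then show ?case using add[of "g x" "c x"] by simp
qed

lemma power_of: "B g c \<Longrightarrow> B (\<lambda>k. g k ^ i) (c ^ i)"
proof (induction i)
  case 0
  then show ?case using const[of 1 1] by simp
next
  case (Suc i)
  then show ?case using mult[of g c "\<lambda>k. g k ^ i" "c ^ i"] by simp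
qed

text \<open>
  Riemann sums are finite combinations of multipliers. Since only finitely many levels occur, one
  tagged division can serve all of them and the integral of the bounds at once, so the limit rule
  applies to the sums.
\<close>
lemma integral:
  assumes g: "\<And>k. k \<le> n \<Longrightarrow> ((\<lambda>u. g u k) has_integral G k) {a..b::real}"
    and c: "(c has_integral C) {a..b}"
    and B: "\<And>u. u \<in> {a..b} \<Longrightarrow> B (g u) (c u)"
  shows "B G C"
proof -
  have "\<exists>D. D tagged_division_of (cbox a b) \<and>
      (\<forall>k\<le>n. \<bar>(\<Sum>(x,K)\<in>D. measure lborel K * g x k) - G k\<bar> < 1 / Suc i) \<and>
      \<bar>(\<Sum>(x,K)\<in>D. measure lborel K * c x) - C\<bar> < 1 / Suc i" for i :: nat
  proof -
    have "\<exists>\<gamma>. gauge \<gamma> \<and> (\<forall>D. D tagged_division_of (cbox a b) \<and> \<gamma> fine D \<longrightarrow>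
            norm ((\<Sum>(x,K)\<in>D. measure lborel K *\<^sub>R g x k) - G k) < 1 / Suc i)" if "k \<le> n" for k
      using g[OF that] unfolding cbox_interval[symmetric] has_integral by simp
    then obtain \<gamma> where \<gamma>: "\<And>k. k \<le> n \<Longrightarrow> gauge (\<gamma> k)"
      "\<And>k D. k \<le> n \<Longrightarrow> D tagged_division_of (cbox a b) \<Longrightarrow> \<gamma> k fine D \<Longrightarrow>
            norm ((\<Sum>(x,K)\<in>D. measure lborel K *\<^sub>R g x k) - G k) < 1 / Suc i"
      by metis
    have "\<exists>\<gamma>. gauge \<gamma> \<and> (\<forall>D. D tagged_division_of (cbox a b) \<and> \<gamma> fine D \<longrightarrow>
            norm ((\<Sum>(x,K)\<in>D. measure lborel K *\<^sub>R c x) - C) < 1 / Suc i)"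
      using c unfolding cbox_interval[symmetric] has_integral by simp
    then obtain \<eta> where \<eta>: "gauge \<eta>"
      "\<And>D. D tagged_division_of (cbox a b) \<Longrightarrow> \<eta> fine D \<Longrightarrow>
            norm ((\<Sum>(x,K)\<in>D. measure lborel K *\<^sub>R c x) - C) < 1 / Suc i"
      by metis
    have "gauge (\<lambda>x. \<Inter>{\<gamma> k x | k. k \<in> {..n}})"
      using gauge_Inter[of "{..n}" \<gamma>] \<gamma>(1) by auto
    then have "gauge (\<lambda>x. \<eta> x \<inter> \<Inter>{\<gamma> k x | k. k \<in> {..n}})"
      using \<eta>(1) gauge_Int by blast
    then obtain D where D: "D tagged_division_of (cbox a b)"
      "(\<lambda>x. \<eta> x \<inter> \<Inter>{\<gamma> k x | k. k \<in> {..n}}) fine D"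
      using fine_division_exists by blast
    have "\<eta> fine D" "\<And>k. k \<le> n \<Longrightarrow> \<gamma> k fine D"
      using D(2) unfolding fine_def by fastforce+
    then show ?thesis using \<gamma>(2) \<eta>(2) D(1) by (intro exI[of _ D]) auto
  qed
  then obtain D where D: "\<And>i::nat. D i tagged_division_of (cbox a b)"
      "\<And>i k. k\<le>n \<Longrightarrow> \<bar>(\<Sum>(x,K)\<in>D i. measure lborel K * g x k) - G k\<bar> < 1 / Suc i"
      "\<And>i. \<bar>(\<Sum>(x,K)\<in>D i. measure lborel K * c x) - C\<bar> < 1 / Suc i"
    by metis
  have lim: "f \<longlonglongrightarrow> l" if "\<And>i. \<bar>f i - l\<bar> < 1 / real (Suc i)" for f and l :: real
  proof -
    have "(\<lambda>i. f i - l) \<longlonglongrightarrow> 0"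
      by (rule Lim_null_comparison[OF _ LIMSEQ_inverse_real_of_nat])
         (use that in \<open>auto simp: inverse_eq_divide intro!: always_eventually less_imp_le\<close>)
    then show ?thesis using LIM_zero_iff by blast
  qed
  show ?thesis
  proof (rule limit[of "\<lambda>i k. \<Sum>(x,K)\<in>D i. measure lborel K * g x k" "\<lambda>i. \<Sum>(x,K)\<in>D i. measure lborel K * c x"])
    fix i
    have "B (\<lambda>k. \<Sum>z\<in>D i. measure lborel (snd z) * g (fst z) k) (\<Sum>z\<in>D i. \<bar>measure lborel (snd z)\<bar> * c (fst z))"
    proof (rule finite_sum)
      show "finite (D i)" using D(1) by blast
      fix z assume "z \<in> D i"
      then have "fst z \<in> {a..b}"
        using D(1)[of i] tag_in_interval[of "D i" "cbox a b" "fst z" "snd z"] by auto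
      then show "B (\<lambda>k. measure lborel (snd z) * g (fst z) k) (\<bar>measure lborel (snd z)\<bar> * c (fst z))"
        using B scale by blast
    qed
    then show "B (\<lambda>k. \<Sum>(x,K)\<in>D i. measure lborel K * g x k) (\<Sum>(x,K)\<in>D i. measure lborel K * c x)"
      by (simp add: case_prod_beta)
  qed (use D lim in auto)
qed

text \<open>
  The operators act on real Banach spaces, so a complex multiplier is bounded through its real and
  imaginary parts; products with complex scalars therefore cost a factor \<open>2\<close>.
\<close>
definition BC :: "(nat \<Rightarrow> complex) \<Rightarrow> real \<Rightarrow> bool" where
  "BC g c \<longleftrightarrow> B (\<lambda>k. Re (g k)) c \<and> B (\<lambda>k. Im (g k)) c"

lemma BC_add: "BC g c \<Longrightarrow> BC h d \<Longrightarrow> BC (\<lambda>k. g k + h k) (c + d)"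
  using add by (auto simp: BC_def)

lemma BC_mono: "BC g c \<Longrightarrow> c \<le> d \<Longrightarrow> BC g d"
  using mono by (auto simp: BC_def)

lemma BC_cong: "BC g c \<Longrightarrow> (\<And>k. k \<le> n \<Longrightarrow> g k = h k) \<Longrightarrow> BC h c"
  using cong[of "\<lambda>k. Re (g k)" c "\<lambda>k. Re (h k)"] cong[of "\<lambda>k. Im (g k)" c "\<lambda>k. Im (h k)"]
  by (simp add: BC_def)

lemma BC_of_real: "B g c \<Longrightarrow> 0 \<le> c \<Longrightarrow> BC (\<lambda>k. complex_of_real (g k)) c"
  using const[of 0 c] by (auto simp: BC_def)

lemma BC_mult_B: "BC g c \<Longrightarrow> B h d \<Longrightarrow> BC (\<lambda>k. g k * complex_of_real (h k)) (c * d)"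
  using mult by (auto simp: BC_def)

lemma BC_minus: "BC g c \<Longrightarrow> BC (\<lambda>k. - g k) c"
  using scale[of "\<lambda>k. Re (g k)" c "-1"] scale[of "\<lambda>k. Im (g k)" c "-1"] by (auto simp: BC_def)

lemma BC_cnj: "BC g c \<Longrightarrow> BC (\<lambda>k. cnj (g k)) c"
  using scale[of "\<lambda>k. Im (g k)" c "-1"] by (auto simp: BC_def)

lemma BC_scale:
  assumes "BC g c" "0 \<le> c"
  shows "BC (\<lambda>k. z * g k) (2 * cmod z * c)"
proof -
  have *: "\<bar>Re z\<bar> * c \<le> cmod z * c" "\<bar>Im z\<bar> * c \<le> cmod z * c"
    using assms(2) abs_Re_le_cmod abs_Im_le_cmod by (auto intro!: mult_right_mono)
  have "B (\<lambda>k. Re z * Re (g k) + (- Im z) * Im (g k)) (\<bar>Re z\<bar> * c + \<bar>-Im z\<bar> * c)"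
    by (intro add scale) (use assms in \<open>auto simp: BC_def\<close>)
  moreover have "B (\<lambda>k. Re z * Im (g k) + Im z * Re (g k)) (\<bar>Re z\<bar> * c + \<bar>Im z\<bar> * c)"
    by (intro add scale) (use assms in \<open>auto simp: BC_def\<close>)
  ultimately show ?thesis
    unfolding BC_def using * by (auto elim!: mono)
qed

lemma BC_integral:
  assumes g: "\<And>k. k \<le> n \<Longrightarrow> ((\<lambda>u. g u k) has_integral G k) {a..b::real}"
    and c: "(c has_integral C) {a..b}"
    and B: "\<And>u. u \<in> {a..b} \<Longrightarrow> BC (g u) (c u)"
  shows "BC G C"
  unfolding BC_def
proof
  show "B (\<lambda>k. Re (G k)) C"
    by (rule integral[of "\<lambda>u k. Re (g u k)" _ a b c])
       (use assms in \<open>auto simp: BC_def intro: has_integral_Re\<close>)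
  show "B (\<lambda>k. Im (G k)) C"
    by (rule integral[of "\<lambda>u k. Im (g u k)" _ a b c])
       (use assms in \<open>auto simp: BC_def intro: has_integral_Im\<close>)
qed

lemma BC_limit:
  assumes "\<And>i::nat. BC (gs i) (cs i)" "\<And>k. k \<le> n \<Longrightarrow> (\<lambda>i. gs i k) \<longlonglongrightarrow> g k" "cs \<longlonglongrightarrow> c"
  shows "BC g c"
  unfolding BC_def
proof
  show "B (\<lambda>k. Re (g k)) c"
    by (rule limit[of "\<lambda>i k. Re (gs i k)", OF _ _ assms(3)])
       (use assms in \<open>auto simp: BC_def intro: tendsto_Re\<close>)
  show "B (\<lambda>k. Im (g k)) c"
    by (rule limit[of "\<lambda>i k. Im (gs i k)", OF _ _ assms(3)])
       (use assms in \<open>auto simp: BC_def intro: tendsto_Im\<close>)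
qed

end

section \<open>Resolvents and complex times\<close>

text \<open>
  The triangle with vertices \<open>0\<close>, \<open>X (\<delta> - \<i>)\<close> and \<open>X (\<delta> + \<i>)\<close> is run through
  counterclockwise and contains the real points between \<open>0\<close> and \<open>\<delta> X\<close> in its interior.
\<close>
lemma cauchy_triangle:
  fixes G :: "complex \<Rightarrow> complex" and \<delta> X k :: real
  assumes G: "G holomorphic_on UNIV" and \<delta>: "0 < \<delta>" and k: "0 < k" "k < \<delta> * X"
  defines "Q \<equiv> of_real X * (of_real \<delta> + \<i>)"
  shows "((\<lambda>w. G w / (w - of_real k)) has_contour_integral (2 * pi * \<i> * G k))
           (linepath 0 (cnj Q) +++ linepath (cnj Q) Q +++ linepath Q 0)"
proof -
  let ?\<gamma> = "linepath 0 (cnj Q) +++ linepath (cnj Q) Q +++ linepath Q 0"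
  let ?z = "complex_of_real k"
  have X: "0 < X" using \<delta> k by (smt (verit) zero_less_mult_pos)
  have Q: "Re Q = \<delta> * X" "Im Q = X" by (auto simp: Q_def)
  have ncol: "\<not> collinear {0, cnj Q, Q}"
  proof
    assume "collinear {0, cnj Q, Q}"
    then consider "cnj Q = 0" | "Q = 0" | c where "Q = c *\<^sub>R cnj Q"
      unfolding collinear_lemma by blast
    then show False
    proof cases
      case 3
      then have "Re Q = c * Re Q" "Im Q = - c * Im Q" 
        by (metis scaleR_complex.sel(1) cnj.sel(1), metis scaleR_complex.sel(2) cnj.sel(2) mult_minus_left mult_minus_right)
      then have "c = 1" "c = -1" using Q X \<delta> by auto
      then show False by simp
    qed (use Q X in auto)
  qed
  define y where "y = k / (2 * \<delta> * X)"
  have y: "0 < y" "2 * y < 1" using k \<delta> X by (auto simp: y_def field_simps)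
  have "?z = (1 - 2*y) *\<^sub>R 0 + y *\<^sub>R cnj Q + y *\<^sub>R Q"
    using \<delta> X by (simp add: complex_eq_iff Q y_def field_simps)
  then have int: "?z \<in> interior (convex hull {0, cnj Q, Q})"
    unfolding interior_convex_hull_3_minimal[OF ncol DIM_complex]
    using y by (intro CollectI exI[of _ "1 - 2*y"] exI[of _ y] conjI) auto
  have "Im ((cnj Q - 0) * cnj (cnj Q - ?z)) = X * k"
    by (simp add: Q algebra_simps)
  moreover have "0 < X * k" using X k by simp
  ultimately have wn: "winding_number ?\<gamma> ?z = 1"
    using winding_number_triangle[OF int] by simp
  have "?z \<notin> path_image ?\<gamma>"
    using int interior_of_triangle[of 0 "cnj Q" Q] by (auto simp: path_image_join)
  then have "((\<lambda>w. G w / (w - ?z)) has_contour_integral (2 * pi * \<i> * winding_number ?\<gamma> ?z * G ?z)) ?\<gamma>"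
    by (intro Cauchy_integral_formula_convex_simple[OF _ G]) auto
  then show ?thesis unfolding wn by simp
qed

text \<open>
  Inverses of \<open>1 + \<kappa> T\<close> with \<open>\<kappa>\<close> strictly greater than \<open>1\<close>, uniform over the noise operators \<open>T\<close>,
  are what makes the semigroup analytic in a sector. With \<open>\<kappa> = 1\<close> only the resolvent on the imaginary
  axis would be reached; the excess over \<open>1\<close> tilts the axis into the right half plane.
\<close>
locale analytic_multipliers = level_multipliers +
  fixes \<kappa> C\<^sub>0 :: real
  assumes \<kappa>: "1 < \<kappa>"
    and inverse: "0 \<le> x \<Longrightarrow> x \<le> 1 \<Longrightarrow> B (\<lambda>k. 1 / (1 + \<kappa> * x ^ k)) C\<^sub>0"
    and C\<^sub>0: "0 \<le> C\<^sub>0"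
begin

text \<open>
  The inclination for which a point \<open>z = s (\<delta> + \<i>)\<close> satisfies \<open>exp (z t) = - \<kappa>\<close> at \<open>t = \<pi> / s\<close>.
\<close>
definition \<delta> :: real where "\<delta> = ln \<kappa> / pi"

lemma \<delta>_pos: "0 < \<delta>" using \<kappa> by (simp add: \<delta>_def)

lemma exp_\<delta>: "exp (\<delta> * pi) = \<kappa>" using \<kappa> by (simp add: \<delta>_def)

text \<open>
  Integrate \<open>exp ((z - k) u)\<close> over \<open>0 \<le> u \<le> t = \<pi> / s\<close>. As \<open>exp (z t) = - \<kappa>\<close>, the integral equals
  \<open>- (1 + \<kappa> exp (- t k)) / (z - k)\<close>: it is the resolvent times an operator whose inverse is bounded by
  assumption. The integral itself is an average of noise operators with weights of modulus at
  most \<open>\<kappa>\<close>.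
\<close>
lemma resolvent:
  assumes s: "0 < s"
  shows "BC (\<lambda>k. 1 / (of_real s * (of_real \<delta> + \<i>) - of_nat k)) (C\<^sub>0 * \<kappa> * pi / s)"
proof -
  define z where "z = complex_of_real s * (of_real \<delta> + \<i>)"
  define t where "t = pi / s"
  have t: "0 < t" "s * t = pi" using s by (auto simp: t_def)
  have nz: "z - of_nat k \<noteq> 0" for k
    using s by (auto simp: z_def complex_eq_iff)
  have "z * of_real t = of_real (s * t * \<delta>) + of_real (s * t) * \<i>"
    by (simp add: z_def algebra_simps)
  then have ezt: "exp (z * of_real t) = - of_real \<kappa>"
    by (simp only: exp_add exp_of_real t(2) exp_pi_i exp_\<delta> mult.commute[of pi \<delta>] mult_minus_right mult_1_right)
  have ee: "exp ((z - of_nat k) * of_real u) = exp (z * of_real u) * of_real (exp (-u) ^ k)" for k u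
  proof -
    have "(z - of_nat k) * of_real u = z * of_real u + of_nat k * of_real (- u)"
      by (simp add: algebra_simps)
    then show ?thesis
      by (simp only: exp_add exp_of_nat_mult exp_of_real of_real_power)
  qed
  define J where "J k = (exp ((z - of_nat k) * of_real t) - 1) / (z - of_nat k)" for k :: nat
  have J: "((\<lambda>u. exp ((z - of_nat k) * of_real u)) has_integral J k) {0..t}" for k :: nat
  proof -
    have "((\<lambda>u. exp ((z - of_nat k) * of_real u)) has_integral
        (exp ((z - of_nat k) * of_real t) / (z - of_nat k)
           - exp ((z - of_nat k) * of_real 0) / (z - of_nat k))) {0..t}"
    proof (rule fundamental_theorem_of_calculus)
      fix u assume "u \<in> {0..t}"
      have "((\<lambda>w. exp ((z - of_nat k) * w) / (z - of_nat k)) has_field_derivative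
              exp ((z - of_nat k) * of_real u)) (at (of_real u))"
        using nz[of k] by (auto intro!: derivative_eq_intros)
      then show "((\<lambda>u. exp ((z - of_nat k) * of_real u) / (z - of_nat k)) has_vector_derivative
              exp ((z - of_nat k) * of_real u)) (at u within {0..t})"
        by (rule has_vector_derivative_real_field)
    qed (use t in auto)
    then show ?thesis by (simp add: J_def diff_divide_distrib)
  qed
  have bound: "BC (\<lambda>k. exp ((z - of_nat k) * of_real u)) \<kappa>" if u: "u \<in> {0..t}" for u
  proof -
    have "Re (z * of_real u) \<le> \<delta> * pi"
    proof -
      have "Re (z * of_real u) = \<delta> * (s * u)" by (simp add: z_def)
      also have "\<dots> \<le> \<delta> * (s * t)" using u s \<delta>_pos by (intro mult_left_mono) auto
      finally show ?thesis using t by simp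
    qed
    then have "exp (Re (z * of_real u)) \<le> \<kappa>" using exp_\<delta> by (metis exp_le_cancel_iff)
    then have n: "cmod (exp (z * of_real u)) \<le> \<kappa>" by simp
    have e: "exp ((z - of_nat k) * of_real u) = exp (z * of_real u) * of_real (exp (-u) ^ k)" for k
      by (rule ee)
    have ReIm: "Re (w * of_real r) = Re w * r" "Im (w * of_real r) = Im w * r" for w r by simp_all
    have p: "B (\<lambda>k. exp (-u) ^ k) 1" using u by (intro power) auto
    have "B (\<lambda>k. a * exp (-u) ^ k) \<kappa>" if "\<bar>a\<bar> \<le> \<kappa>" for a
      using mult[OF const[OF that] p] by simp
    then show ?thesis
      unfolding BC_def e ReIm
      using order_trans[OF abs_Re_le_cmod n] order_trans[OF abs_Im_le_cmod n] by blast
  qed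
  have BJ: "BC J (\<kappa> * t)"
    by (rule BC_integral[OF J _ bound])
       (use t has_integral_const_real[of \<kappa> 0 t] in \<open>auto simp: mult.commute\<close>)
  have "BC (\<lambda>k. J k * of_real (1 / (1 + \<kappa> * exp (-t) ^ k))) (\<kappa> * t * C\<^sub>0)"
    by (intro BC_mult_B[OF BJ] inverse) (use t in auto)
  then have "BC (\<lambda>k. - (J k * of_real (1 / (1 + \<kappa> * exp (-t) ^ k)))) (\<kappa> * t * C\<^sub>0)"
    by (rule BC_minus)
  moreover have "- (J k * of_real (1 / (1 + \<kappa> * exp (-t) ^ k))) = 1 / (z - of_nat k)" for k
  proof -
    have "exp ((z - of_nat k) * of_real t) = - of_real (\<kappa> * exp (-t) ^ k)"
      unfolding ee ezt by simp
    then have "J k = - of_real (1 + \<kappa> * exp (-t) ^ k) / (z - of_nat k)"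
      by (simp add: J_def)
    moreover have "1 + \<kappa> * exp (-t) ^ k \<noteq> 0" using \<kappa> by (smt (verit) exp_gt_zero mult_pos_pos zero_less_power)
    ultimately show ?thesis using nz[of k] by (simp add: field_simps del: of_real_add of_real_mult of_real_power)
  qed
  ultimately show ?thesis unfolding z_def t_def by (simp add: mult_ac)
qed

definition C\<^sub>1 :: real where "C\<^sub>1 = C\<^sub>0 * \<kappa> * pi"

lemma C\<^sub>1: "0 \<le> C\<^sub>1" using C\<^sub>0 \<kappa> by (simp add: C\<^sub>1_def)

lemma resolvent_sym:
  assumes s: "0 < s" and \<sigma>: "\<sigma> = 1 \<or> \<sigma> = -1"
  shows "BC (\<lambda>k. 1 / (of_real s * (of_real \<delta> + of_real \<sigma> * \<i>) - of_nat k)) (C\<^sub>1 / s)"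
  using \<sigma>
proof
  assume "\<sigma> = 1"
  then show ?thesis using resolvent[OF s] by (simp add: C\<^sub>1_def)
next
  assume "\<sigma> = -1"
  then show ?thesis using BC_cnj[OF resolvent[OF s]] by (simp add: C\<^sub>1_def)
qed

text \<open>
  A real part of the time that makes \<open>exp (- (decay + \<i> b) w)\<close> decay at least like \<open>exp (- Re w / \<delta>)\<close> along
  the rays of slope \<open>\<plusminus> 1 / \<delta>\<close>, for all \<open>0 \<le> b \<le> 2 \<pi>\<close>, with room for the crude bound in
  \<open>semigroup_gap_bound\<close>.
\<close>
definition decay :: real where "decay = (2 * pi * (1 + \<delta>) + 1) / \<delta>"

text \<open>
  The complex time is compared with the real time \<open>decay\<close>: the real semigroup is contractive anyway,
  and the difference vanishes at \<open>w = 0\<close>, which cancels the singularity \<open>1 / \<bar>w\<bar>\<close> of the resolvent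
  bound at the vertex of the sector.
\<close>
definition semigroup_gap :: "real \<Rightarrow> complex \<Rightarrow> complex" where
  "semigroup_gap b w = exp (- (of_real decay + \<i> * of_real b) * w) - exp (- of_real decay * w)"

lemma semigroup_gap_holomorphic: "semigroup_gap b holomorphic_on S"
  unfolding semigroup_gap_def by (intro holomorphic_intros)

lemma semigroup_gap_bound:
  assumes b: "0 \<le> b" "b \<le> 2 * pi" and X: "0 \<le> X" and w: "Re w = \<delta> * X" "cmod w \<le> (1 + \<delta>) * X"
  shows "cmod (semigroup_gap b w) \<le> 2 * pi * (1 + \<delta>) * X * exp (- X)"
proof -
  define \<zeta> where "\<zeta> = - \<i> * of_real b * w"
  have n\<zeta>: "cmod \<zeta> \<le> 2 * pi * (1 + \<delta>) * X"
  proof -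
    have "cmod \<zeta> = b * cmod w" using b by (simp add: \<zeta>_def norm_mult)
    also have "\<dots> \<le> (2 * pi) * ((1 + \<delta>) * X)" using b w by (intro mult_mono) auto
    finally show ?thesis by (simp add: mult_ac)
  qed
  have "semigroup_gap b w = exp (- of_real decay * w) * (exp \<zeta> - 1)"
    by (simp add: semigroup_gap_def \<zeta>_def algebra_simps flip: exp_add)
  then have "cmod (semigroup_gap b w) = exp (- decay * (\<delta> * X)) * cmod (exp \<zeta> - 1)"
    by (simp add: norm_mult w)
  also have "\<dots> \<le> exp (- decay * (\<delta> * X)) * (cmod \<zeta> * exp (cmod \<zeta>))"
  proof (intro mult_left_mono)
    have "cmod (exp \<zeta> - exp 0) \<le> exp (cmod \<zeta>) * cmod (\<zeta> - 0)"
    proof (rule field_differentiable_bound[of "cball 0 (cmod \<zeta>)"])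
      show "(exp has_field_derivative exp z) (at z within cball 0 (cmod \<zeta>))" for z :: complex
        using DERIV_exp DERIV_subset by blast
      show "cmod (exp z) \<le> exp (cmod \<zeta>)" if "z \<in> cball 0 (cmod \<zeta>)" for z
        using that by (intro order_trans[OF norm_exp]) simp
    qed auto
    then show "cmod (exp \<zeta> - 1) \<le> cmod \<zeta> * exp (cmod \<zeta>)" by (simp add: mult.commute)
  qed auto
  also have "\<dots> \<le> exp (- decay * (\<delta> * X)) * (2 * pi * (1 + \<delta>) * X * exp (2 * pi * (1 + \<delta>) * X))"
    using n\<zeta> X \<delta>_pos by (intro mult_left_mono mult_mono) auto
  also have "\<dots> = 2 * pi * (1 + \<delta>) * X * exp (- decay * (\<delta> * X) + 2 * pi * (1 + \<delta>) * X)"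
    unfolding exp_add by (simp only: mult_ac)
  also have "- decay * (\<delta> * X) + 2 * pi * (1 + \<delta>) * X = - X"
    using \<delta>_pos by (simp add: decay_def field_simps)
  finally show ?thesis .
qed

definition ray_const :: real where "ray_const = 8 * pi * (1 + \<delta>)\<^sup>2 * C\<^sub>1"

lemma ray_const: "0 \<le> ray_const" using C\<^sub>1 by (simp add: ray_const_def)

text \<open>
  The Cauchy integrand on a ray is \<open>semigroup_gap b w\<close> times the resolvent at \<open>w\<close>, and the linear zero
  of the first factor compensates the bound \<open>C\<^sub>1 / s\<close> of the second. What remains is dominated by
  \<open>exp (- s)\<close>, so that the bound is independent of the length of the ray. Level \<open>0\<close> is masked since the
  point \<open>0\<close> lies on the ray.
\<close>
lemma ray_integral_bound:
  assumes b: "0 \<le> b" "b \<le> 2 * pi" and X: "0 < X" and \<sigma>: "\<sigma> = 1 \<or> \<sigma> = -1"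
  defines "Q \<equiv> complex_of_real X * (of_real \<delta> + of_real \<sigma> * \<i>)"
  shows "BC (\<lambda>k. if k = 0 then 0 else contour_integral (linepath 0 Q) (\<lambda>w. semigroup_gap b w / (w - of_nat k))) ray_const"
proof -
  have Q: "Re Q = \<delta> * X" "cmod Q \<le> (1 + \<delta>) * X"
  proof -
    show "Re Q = \<delta> * X" by (simp add: Q_def)
    have "cmod Q \<le> X * (\<delta> + 1)"
      unfolding Q_def norm_mult using X \<delta>_pos \<sigma>
        norm_triangle_ineq[of "complex_of_real \<delta>" "of_real \<sigma> * \<i>"]
      by (auto intro!: mult_mono simp: norm_mult)
    then show "cmod Q \<le> (1 + \<delta>) * X" by (simp add: mult.commute add.commute)
  qed
  have imQ: "Im Q \<noteq> 0" using X \<sigma> by (auto simp: Q_def)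
  show ?thesis
  proof (rule BC_mono[OF BC_integral])
    let ?g = "\<lambda>u k. if k = 0 then 0 else semigroup_gap b (of_real u * Q) / (of_real u * Q - of_nat k) * Q"
    fix k :: nat
    show "((\<lambda>u. ?g u k) has_integral (if k = 0 then 0 else
             contour_integral (linepath 0 Q) (\<lambda>w. semigroup_gap b w / (w - of_nat k)))) {0..1}"
    proof (cases "k = 0")
      case False
      have "of_nat k \<notin> closed_segment 0 Q"
      proof
        assume "of_nat k \<in> closed_segment 0 Q"
        then obtain u where "complex_of_nat k = u *\<^sub>R Q"
          by (auto simp: closed_segment_def)
        then have "u * Im Q = 0" "u * Re Q = real k" by (auto simp: complex_eq_iff)
        then show False using imQ False by auto
      qed
      then have "continuous_on (closed_segment 0 Q) (\<lambda>w. semigroup_gap b w / (w - of_nat k))"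
        by (intro continuous_intros holomorphic_on_imp_continuous_on[OF semigroup_gap_holomorphic]) auto
      then have "((\<lambda>w. semigroup_gap b w / (w - of_nat k)) has_contour_integral
          contour_integral (linepath 0 Q) (\<lambda>w. semigroup_gap b w / (w - of_nat k))) (linepath 0 Q)"
        by (intro has_contour_integral_integral contour_integrable_continuous_linepath)
      then show ?thesis using False
        unfolding has_contour_integral_linepath by (simp add: linepath_def scaleR_conv_of_real)
    qed simp
  next
    show "((\<lambda>u. ray_const * X * exp (- X * u)) has_integral (ray_const - ray_const * exp (- X))) {0..1}"
    proof -
      have "((\<lambda>u. ray_const * X * exp (- X * u)) has_integral (- ray_const * exp (- X * 1) - (- ray_const * exp (- X * 0)))) {0..1}"
        by (rule fundamental_theorem_of_calculus)
           (auto intro!: derivative_eq_intros simp flip: has_real_derivative_iff_has_vector_derivative)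
      then show ?thesis by simp
    qed
  next
    fix u :: real assume u: "u \<in> {0..1}"
    let ?g = "\<lambda>k. if k = 0 then 0 else semigroup_gap b (of_real u * Q) / (of_real u * Q - of_nat k) * Q"
    show "BC ?g (ray_const * X * exp (- X * u))"
    proof (cases "u = 0")
      case True
      have "BC (\<lambda>k. 0) (ray_const * X * exp (- X * u))"
        using const[of 0 "ray_const * X * exp (- X * u)"] ray_const X by (simp add: BC_def)
      moreover have "?g = (\<lambda>k. 0)" by (simp add: True semigroup_gap_def fun_eq_iff)
      ultimately show ?thesis by simp
    next
      case False
      define s where "s = u * X"
      have s: "0 < s" using u False X by (auto simp: s_def)
      have uQ: "of_real u * Q = of_real s * (of_real \<delta> + of_real \<sigma> * \<i>)"
        by (simp add: s_def Q_def mult_ac)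
      \<comment> \<open>The multiplier \<open>0 ^ k\<close> is the projection onto level \<open>0\<close>; its complement is the mask.\<close>
      have "B (\<lambda>k. 1 + (-1) * 0 ^ k) (1 + \<bar>-1\<bar> * 1)"
        by (intro add scale power const) auto
      then have "BC (\<lambda>k. (semigroup_gap b (of_real u * Q) * Q) *
            (1 / (of_real u * Q - of_nat k) * complex_of_real (1 + (-1) * 0 ^ k)))
            (2 * cmod (semigroup_gap b (of_real u * Q) * Q) * (C\<^sub>1 / s * (1 + \<bar>-1\<bar> * 1)))"
        unfolding uQ by (intro BC_scale BC_mult_B resolvent_sym s \<sigma>) (use C\<^sub>1 s in auto)
      then have BCg: "BC ?g (2 * cmod (semigroup_gap b (of_real u * Q) * Q) * (C\<^sub>1 / s * 2))"
        by (rule BC_mono[OF BC_cong]) auto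
      have "cmod (semigroup_gap b (of_real u * Q)) \<le> 2 * pi * (1 + \<delta>) * s * exp (- s)"
      proof (rule semigroup_gap_bound[OF b])
        show "Re (of_real u * Q) = \<delta> * s" by (simp add: s_def Q)
        have "cmod (of_real u * Q) = u * cmod Q" using u by (simp add: norm_mult)
        also have "\<dots> \<le> u * ((1 + \<delta>) * X)" using u Q by (intro mult_left_mono) auto
        finally show "cmod (of_real u * Q) \<le> (1 + \<delta>) * s" by (simp add: s_def mult_ac)
      qed (use s in auto)
      then have "cmod (semigroup_gap b (of_real u * Q) * Q) \<le> (2 * pi * (1 + \<delta>) * s * exp (- s)) * ((1 + \<delta>) * X)"
        unfolding norm_mult using Q s \<delta>_pos by (intro mult_mono) auto
      then have "2 * cmod (semigroup_gap b (of_real u * Q) * Q) * (C\<^sub>1 / s * 2)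
          \<le> 2 * ((2 * pi * (1 + \<delta>) * s * exp (- s)) * ((1 + \<delta>) * X)) * (C\<^sub>1 / s * 2)"
        using C\<^sub>1 s by (intro mult_right_mono mult_left_mono) auto
      also have "\<dots> = ray_const * X * exp (- X * u)"
        using s False X by (simp add: ray_const_def power2_eq_square s_def mult_ac)
      finally show ?thesis using BCg BC_mono by blast
    qed
  next
    show "ray_const - ray_const * exp (- X) \<le> ray_const" using ray_const by simp
  qed
qed

text \<open>
  The two rays and the vertical side form the triangle of \<open>cauchy_triangle\<close>. On the vertical side the
  integrand is as small as \<open>X exp (- X)\<close>, because the distance of the side to \<open>k\<close> is at least \<open>1\<close>.
\<close>
lemma contour_decomposition:
  assumes b: "0 \<le> b" "b \<le> 2 * pi" and k: "0 < k" "k + 1 \<le> \<delta> * X"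
  defines "Q \<equiv> complex_of_real X * (of_real \<delta> + \<i>)"
  shows "cmod (contour_integral (linepath 0 (cnj Q)) (\<lambda>w. semigroup_gap b w / (w - of_real k))
          - contour_integral (linepath 0 Q) (\<lambda>w. semigroup_gap b w / (w - of_real k))
          - 2 * pi * \<i> * semigroup_gap b (of_real k)) \<le> 4 * pi * (1 + \<delta>) * X\<^sup>2 * exp (- X)"
proof -
  let ?f = "\<lambda>w. semigroup_gap b w / (w - of_real k)"
  have X: "0 < X" using \<delta>_pos k by (smt (verit) zero_less_mult_pos)
  have Q: "Re Q = \<delta> * X" "Im Q = X" by (auto simp: Q_def)
  have cont: "continuous_on S ?f" if "complex_of_real k \<notin> S" for S
    using that by (intro continuous_intros holomorphic_on_imp_continuous_on[OF semigroup_gap_holomorphic]) auto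
  have notin: "complex_of_real k \<notin> closed_segment 0 w" if "Im w \<noteq> 0" for w
  proof
    assume "of_real k \<in> closed_segment 0 w"
    then obtain u where "complex_of_real k = u *\<^sub>R w"
      by (auto simp: closed_segment_def)
    then have "u * Im w = 0" "u * Re w = k" by (auto simp: complex_eq_iff)
    then show False using that k by auto
  qed
  have side: "Re w = \<delta> * X \<and> \<bar>Im w\<bar> \<le> X" if w: "w \<in> closed_segment (cnj Q) Q" for w
  proof -
    obtain u where u: "w = (1 - u) *\<^sub>R cnj Q + u *\<^sub>R Q" "0 \<le> u" "u \<le> 1"
      using w by (auto simp: closed_segment_def)
    have "\<bar>2 * u - 1\<bar> * X \<le> 1 * X" using u X by (intro mult_right_mono) auto
    moreover have "Im w = (2 * u - 1) * X" "Re w = \<delta> * X"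
      unfolding u(1) by (simp_all add: Q algebra_simps)
    ultimately show ?thesis using X by (simp add: abs_mult)
  qed
  have i1: "(?f has_contour_integral contour_integral (linepath 0 (cnj Q)) ?f) (linepath 0 (cnj Q))"
    by (intro has_contour_integral_integral contour_integrable_continuous_linepath cont notin)
       (use X Q in auto)
  have i3: "(?f has_contour_integral contour_integral (linepath 0 Q) ?f) (linepath 0 Q)"
    by (intro has_contour_integral_integral contour_integrable_continuous_linepath cont notin)
       (use X Q in auto)
  have i2: "(?f has_contour_integral contour_integral (linepath (cnj Q) Q) ?f) (linepath (cnj Q) Q)"
    using k side[of "of_real k"]
    by (intro has_contour_integral_integral contour_integrable_continuous_linepath cont) auto
  have "(?f has_contour_integral - contour_integral (linepath 0 Q) ?f) (linepath Q 0)"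
    using has_contour_integral_reversepath[OF valid_path_linepath i3] by simp
  then have "(?f has_contour_integral (contour_integral (linepath 0 (cnj Q)) ?f +
      (contour_integral (linepath (cnj Q) Q) ?f + - contour_integral (linepath 0 Q) ?f)))
      (linepath 0 (cnj Q) +++ linepath (cnj Q) Q +++ linepath Q 0)"
    by (intro has_contour_integral_join i1 i2 valid_path_join) auto
  moreover have "(?f has_contour_integral (2 * pi * \<i> * semigroup_gap b k))
      (linepath 0 (cnj Q) +++ linepath (cnj Q) Q +++ linepath Q 0)"
    unfolding Q_def using k by (intro cauchy_triangle semigroup_gap_holomorphic \<delta>_pos) auto
  ultimately have "contour_integral (linepath 0 (cnj Q)) ?f +
      (contour_integral (linepath (cnj Q) Q) ?f + - contour_integral (linepath 0 Q) ?f) = 2 * pi * \<i> * semigroup_gap b k"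
    by (rule has_contour_integral_unique)
  then have "contour_integral (linepath 0 (cnj Q)) ?f - contour_integral (linepath 0 Q) ?f - 2 * pi * \<i> * semigroup_gap b k
       = - contour_integral (linepath (cnj Q) Q) ?f"
    by (simp add: algebra_simps)
  moreover have "cmod (contour_integral (linepath (cnj Q) Q) ?f) \<le>
      (2 * pi * (1 + \<delta>) * X * exp (- X)) * cmod (Q - cnj Q)"
  proof (rule has_contour_integral_bound_linepath[OF i2])
    fix w assume "w \<in> closed_segment (cnj Q) Q"
    note w = side[OF this]
    have "1 \<le> Re (w - of_real k)" using w k by simp
    then have "1 \<le> cmod (w - of_real k)" using complex_Re_le_cmod order_trans by blast
    moreover have "cmod (semigroup_gap b w) \<le> 2 * pi * (1 + \<delta>) * X * exp (- X)"
    proof (rule semigroup_gap_bound[OF b])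
      have "cmod w \<le> \<bar>Re w\<bar> + \<bar>Im w\<bar>" by (rule cmod_le)
      then show "cmod w \<le> (1 + \<delta>) * X" using w X \<delta>_pos by (simp add: algebra_simps)
    qed (use X w in auto)
    ultimately have "cmod (semigroup_gap b w) / cmod (w - of_real k) \<le> (2 * pi * (1 + \<delta>) * X * exp (- X)) / 1"
      using X \<delta>_pos by (intro frac_le) auto
    then show "cmod (?f w) \<le> 2 * pi * (1 + \<delta>) * X * exp (- X)" by (simp add: norm_divide)
  qed (use X \<delta>_pos in auto)
  moreover have "cmod (Q - cnj Q) = 2 * X"
    using X by (simp add: complex_diff_cnj Q norm_mult)
  ultimately show ?thesis by (simp add: power2_eq_square mult_ac)
qed

text \<open>
  Letting the triangles exhaust the sector, Cauchy's formula represents the multiplier as a limit of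
  ray integrals, pointwise on the finitely many levels. This is the point where bounds for resolvents
  become bounds for complex times.
\<close>
lemma complex_semigroup_difference:
  assumes b: "0 \<le> b" "b \<le> 2 * pi"
  shows "BC (\<lambda>k. semigroup_gap b (of_nat k)) (2 * ray_const / pi)"
proof -
  define Q where "Q i = complex_of_real (real (Suc i)) * (of_real \<delta> + \<i>)" for i
  let ?c = "\<lambda>i k. contour_integral (linepath 0 (cnj (Q i))) (\<lambda>w. semigroup_gap b w / (w - of_nat k))"
  let ?d = "\<lambda>i k. contour_integral (linepath 0 (Q i)) (\<lambda>w. semigroup_gap b w / (w - of_nat k))"
  let ?h = "\<lambda>i k. (1 / (2 * pi * \<i>)) * ((if k = 0 then 0 else ?c i k) + - (if k = 0 then 0 else ?d i k))"
  show ?thesis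
  proof (rule BC_limit)
    fix i
    have Q: "Q i = of_real (real (Suc i)) * (of_real \<delta> + of_real 1 * \<i>)"
      "cnj (Q i) = of_real (real (Suc i)) * (of_real \<delta> + of_real (-1) * \<i>)"
      by (simp_all add: Q_def)
    have "BC (\<lambda>k. if k = 0 then 0 else ?c i k) ray_const"
      unfolding Q(2) by (rule ray_integral_bound[OF b]) simp_all
    moreover have "BC (\<lambda>k. if k = 0 then 0 else ?d i k) ray_const"
      unfolding Q(1) by (rule ray_integral_bound[OF b]) simp_all
    ultimately have "BC (?h i) (2 * cmod (1 / (2 * pi * \<i>)) * (ray_const + ray_const))"
      using ray_const by (intro BC_scale BC_add BC_minus) auto
    then show "BC (?h i) (2 * ray_const / pi)" by (simp add: norm_divide norm_mult)
  next
    fix k assume "k \<le> n"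
    show "(\<lambda>i. ?h i k) \<longlonglongrightarrow> semigroup_gap b (of_nat k)"
    proof (cases "k = 0")
      case True
      then show ?thesis by (simp add: semigroup_gap_def)
    next
      case False
      have "(\<lambda>i. ?c i k - ?d i k - 2 * pi * \<i> * semigroup_gap b (of_nat k)) \<longlonglongrightarrow> 0"
      proof (rule Lim_null_comparison)
        have "eventually (\<lambda>i. real k + 1 \<le> \<delta> * real (Suc i)) sequentially"
          using \<delta>_pos by real_asymp
        then show "eventually (\<lambda>i. cmod (?c i k - ?d i k - 2 * pi * \<i> * semigroup_gap b (of_nat k))
            \<le> 4 * pi * (1 + \<delta>) * (real (Suc i))\<^sup>2 * exp (- real (Suc i))) sequentially"
        proof eventually_elim
          case (elim i)
          then show ?case
            using contour_decomposition[OF b, of "real k" "real (Suc i)"] False by (simp add: Q_def)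
        qed
        show "(\<lambda>i. 4 * pi * (1 + \<delta>) * (real (Suc i))\<^sup>2 * exp (- real (Suc i))) \<longlonglongrightarrow> 0"
          by real_asymp
      qed
      then have "(\<lambda>i. ?c i k - ?d i k) \<longlonglongrightarrow> 2 * pi * \<i> * semigroup_gap b (of_nat k)"
        by (rule LIM_zero_cancel)
      then have "(\<lambda>i. (1 / (2 * pi * \<i>)) * (?c i k - ?d i k)) \<longlonglongrightarrow> (1 / (2 * pi * \<i>)) * (2 * pi * \<i> * semigroup_gap b (of_nat k))"
        by (intro tendsto_intros)
      then show ?thesis using False by simp
    qed
  qed simp
qed

definition level_one_const :: real where "level_one_const = exp decay * (2 * (2 * ray_const / pi + 1))"

text \<open>
  In the time direction \<open>\<i> b\<close> the semigroup has period \<open>2 \<pi>\<close>, with Fourier coefficients the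
  projections onto the levels. The average over the \<open>L\<close>-th roots of unity is exact for levels
  \<open>k \<le> n\<close> as soon as \<open>k - 1\<close> is divisible by \<open>L\<close> for \<open>k = 1\<close> only, and \<open>L = n + 2\<close> also separates
  \<open>k = 0\<close>.
\<close>
theorem level_one: "B (\<lambda>k. if k = 1 then 1 else 0) level_one_const"
proof -
  define L where "L = n + 2"
  define b where "b l = 2 * pi * real l / real L" for l
  have L: "0 < L" by (simp add: L_def)
  have b: "0 \<le> b l" "b l \<le> 2 * pi" if "l < L" for l
    using that L by (auto simp: b_def field_simps)
  let ?g = "\<lambda>l k. exp (\<i> * of_real (b l)) * (semigroup_gap (b l) (of_nat k) + of_real (exp (- decay) ^ k))"
  have decay: "0 \<le> decay" using \<delta>_pos by (simp add: decay_def)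
  have g: "BC (?g l) (2 * (2 * ray_const / pi + 1))" if "l < L" for l
  proof -
    have "BC (\<lambda>k. complex_of_real (exp (- decay) ^ k)) 1"
      by (intro BC_of_real power) (use decay in auto)
    then have "BC (?g l) (2 * cmod (exp (\<i> * of_real (b l))) * (2 * ray_const / pi + 1))"
      using ray_const by (intro BC_scale BC_add complex_semigroup_difference b that) auto
    then show ?thesis by simp
  qed
  have "B (\<lambda>k. \<Sum>l<L. Re (?g l k)) (\<Sum>l<L. 2 * (2 * ray_const / pi + 1))"
    using g by (intro finite_sum) (auto simp: BC_def)
  then have "B (\<lambda>k. (exp decay / L) * (\<Sum>l<L. Re (?g l k))) (\<bar>exp decay / L\<bar> * (\<Sum>l<L. 2 * (2 * ray_const / pi + 1)))"
    by (rule scale)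
  then have *: "B (\<lambda>k. (exp decay / L) * (\<Sum>l<L. Re (?g l k))) level_one_const"
    using L by (simp add: level_one_const_def)
  show ?thesis
  proof (rule cong[OF *])
    fix k assume k: "k \<le> n"
    \<comment> \<open>The shift by \<open>L - 1\<close> stands for \<open>k - 1\<close> modulo \<open>L\<close>, which may be negative.\<close>
    define \<omega> where "\<omega> = exp (2 * of_real pi * \<i> * of_nat (k + (L - 1)) / of_nat L)"
    have "?g l k = exp (- of_real decay * of_nat k) * cnj (\<omega> ^ l)" for l
    proof -
      have bL: "b l * real L = 2 * pi * real l" using L by (simp add: b_def)
      have "exp (\<i> * of_real (b l * real L)) = exp (of_nat l * (2 * of_real pi * \<i>))"
        unfolding bL by (simp add: mult_ac)
      also have "\<dots> = 1" by (simp add: exp_of_nat_mult)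
      finally have 1: "exp (\<i> * of_real (b l * real L)) = 1" .
      have "cnj (\<omega> ^ l) = cnj (exp (of_nat l * (2 * of_real pi * \<i> * of_nat (k + (L - 1)) / of_nat L)))"
        unfolding \<omega>_def by (simp only: exp_of_nat_mult)
      also have "\<dots> = exp (cnj (of_nat l * (2 * of_real pi * \<i> * of_nat (k + (L - 1)) / of_nat L)))"
        by (simp only: exp_cnj)
      also have "cnj (of_nat l * (2 * of_real pi * \<i> * of_nat (k + (L - 1)) / of_nat L))
          = - \<i> * of_real (b l) * of_nat (k + (L - 1))"
        by (simp add: b_def mult_ac)
      also have "\<dots> = \<i> * of_real (b l) - \<i> * of_real (b l) * of_nat k - \<i> * of_real (b l * real L)"
        using L by (simp add: of_nat_diff algebra_simps)
      also have "exp \<dots> = exp (\<i> * of_real (b l) - \<i> * of_real (b l) * of_nat k)"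
        unfolding exp_diff 1 by simp
      finally have \<omega>: "cnj (\<omega> ^ l) = exp (\<i> * of_real (b l) - \<i> * of_real (b l) * of_nat k)" .
      have "exp (- of_real decay * of_nat k) = complex_of_real (exp (- decay) ^ k)"
        unfolding exp_of_nat_mult[symmetric] exp_of_real[symmetric] by (simp add: mult.commute)
      then have "?g l k = exp (\<i> * of_real (b l)) * exp (- (of_real decay + \<i> * of_real (b l)) * of_nat k)"
        by (simp add: semigroup_gap_def)
      also have "\<dots> = exp (- of_real decay * of_nat k) * exp (\<i> * of_real (b l) - \<i> * of_real (b l) * of_nat k)"
        unfolding exp_add[symmetric] by (simp add: algebra_simps)
      finally show ?thesis unfolding \<omega> .
    qed
    then have "(\<Sum>l<L. ?g l k) = exp (- of_real decay * of_nat k) * cnj (\<Sum>l<L. \<omega> ^ l)"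
      by (simp add: sum_distrib_left)
    moreover have "(\<Sum>l<L. \<omega> ^ l) = (if k = 1 then of_nat L else 0)"
    proof -
      have "\<omega> = 1 \<longleftrightarrow> L dvd k + (L - 1)"
        unfolding \<omega>_def by (rule complex_root_unity_eq_1) (use L in simp)
      also have "\<dots> \<longleftrightarrow> k = 1"
      proof
        assume "L dvd k + (L - 1)"
        then obtain c where c: "k + (L - 1) = L * c" by auto
        have "c = 1"
        proof (rule ccontr)
          assume "c \<noteq> 1"
          then consider "c = 0" | "2 \<le> c" by linarith
          then show False
          proof cases
            case 2
            then have "L * 2 \<le> L * c" by simp
            then show False using c k by (simp add: L_def)
          qed (use c in \<open>auto simp: L_def\<close>)
        qed
        then show "k = 1" using c by (simp add: L_def)
      qed (simp add: L_def)
      finally have "\<omega> = 1 \<longleftrightarrow> k = 1" .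
      moreover have "\<omega> ^ L = 1"
        unfolding \<omega>_def using complex_root_unity[of L "k + (L - 1)"] L by simp
      ultimately show ?thesis by (simp add: sum_gp_strict)
    qed
    ultimately have "(\<Sum>l<L. ?g l k) = (if k = 1 then complex_of_real (exp (- decay) * real L) else 0)"
      using exp_of_real[of "- decay", where 'a = complex] by simp
    then have "Re (\<Sum>l<L. ?g l k) = (if k = 1 then exp (- decay) * real L else 0)" by simp
    then have "(\<Sum>l<L. Re (?g l k)) = (if k = 1 then exp (- decay) * real L else 0)"
      unfolding Re_sum .
    moreover have "exp decay * exp (- decay) = 1" by (simp flip: exp_add)
    ultimately show "(exp decay / L) * (\<Sum>l<L. Re (?g l k)) = (if k = 1 then 1 else 0)"
      using L by auto
  qed
qed

end

section \<open>From small powers of differences to inverses\<close>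

context level_multipliers
begin

text \<open>
  Write \<open>1 + \<kappa> T = (1 + \<kappa>) (1 - U)\<close> with \<open>U = \<kappa> (1 - T) / (1 + \<kappa>)\<close>. Since \<open>2 / (1 + \<kappa>) \<le> 1\<close>, the
  assumption makes the norm of \<open>U\<^sup>m\<close> at most \<open>\<kappa>\<^sup>m \<theta> < 1\<close>, and \<open>1 - U\<close> is inverted by the geometric
  series of \<open>U\<^sup>m\<close> multiplied by \<open>1 + U + \<dots> + U\<^sup>m\<^sup>-\<^sup>1\<close>.
\<close>
lemma neumann_inverse:
  assumes diff: "B (\<lambda>k. (1 - x ^ k) ^ m) (\<theta> * 2 ^ m)" and x: "0 \<le> x" "x \<le> 1"
    and \<kappa>: "1 < \<kappa>" "\<kappa> ^ m * \<theta> < 1" and \<theta>: "0 \<le> \<theta>" and m: "0 < m"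
  shows "B (\<lambda>k. 1 / (1 + \<kappa> * x ^ k)) (2 ^ m / (1 - \<kappa> ^ m * \<theta>))"
proof -
  define \<eta> where "\<eta> = \<kappa> ^ m * \<theta>"
  have \<eta>: "0 \<le> \<eta>" "\<eta> < 1" using \<kappa> \<theta> by (auto simp: \<eta>_def)
  define U where "U k = \<kappa> / (1 + \<kappa>) * (1 - x ^ k)" for k :: nat
  have U: "0 \<le> U k" "U k < 1" for k
  proof -
    have p: "0 \<le> x ^ k" "x ^ k \<le> 1" using x by (auto intro: power_le_one)
    then show "0 \<le> U k" using \<kappa> by (simp add: U_def)
    have "U k \<le> \<kappa> / (1 + \<kappa>) * 1"
      unfolding U_def using p \<kappa> by (intro mult_left_mono) auto
    also have "\<dots> < 1" using \<kappa> by simp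
    finally show "U k < 1" .
  qed
  have BU: "B U 2"
  proof -
    have "B (\<lambda>k. \<kappa> / (1 + \<kappa>) * (1 + (-1) * x ^ k)) (\<bar>\<kappa> / (1 + \<kappa>)\<bar> * (1 + \<bar>-1\<bar> * 1))"
      by (intro scale add power x const) auto
    moreover have "\<bar>\<kappa> / (1 + \<kappa>)\<bar> * (1 + \<bar>-1\<bar> * 1) \<le> 2" using \<kappa> by (simp add: field_simps)
    ultimately show ?thesis by (auto simp: U_def[abs_def] elim: mono)
  qed
  have BUm: "B (\<lambda>k. U k ^ m) \<eta>"
  proof -
    have "B (\<lambda>k. (\<kappa> / (1 + \<kappa>)) ^ m * (1 - x ^ k) ^ m) (\<bar>(\<kappa> / (1 + \<kappa>)) ^ m\<bar> * (\<theta> * 2 ^ m))"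
      by (intro scale diff)
    moreover have "\<bar>(\<kappa> / (1 + \<kappa>)) ^ m\<bar> * (\<theta> * 2 ^ m) \<le> \<eta>"
    proof -
      have "\<bar>(\<kappa> / (1 + \<kappa>)) ^ m\<bar> * (\<theta> * 2 ^ m) = (\<kappa> / (1 + \<kappa>) * 2) ^ m * \<theta>"
        using \<kappa> unfolding power_mult_distrib[of "\<kappa> / (1 + \<kappa>)" 2] by simp
      also have "\<dots> \<le> \<kappa> ^ m * \<theta>"
        using \<kappa> \<theta> by (intro mult_right_mono power_mono) (auto simp: field_simps)
      finally show ?thesis by (simp add: \<eta>_def)
    qed
    ultimately show ?thesis unfolding U_def power_mult_distrib by (rule mono)
  qed
  have inv: "B (\<lambda>k. 1 / (1 - U k ^ m)) (1 / (1 - \<eta>))"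
  proof (rule limit)
    show "B (\<lambda>k. \<Sum>j<J. (U k ^ m) ^ j) (\<Sum>j<J. \<eta> ^ j)" for J
      by (intro finite_sum power_of BUm) auto
    show "(\<lambda>J. \<Sum>j<J. (U k ^ m) ^ j) \<longlonglongrightarrow> 1 / (1 - U k ^ m)" for k
    proof -
      have "norm (U k ^ m) < 1" using U[of k] m by (simp add: power_less_one_iff)
      then show ?thesis using geometric_sums sums_def by blast
    qed
    show "(\<lambda>J. \<Sum>j<J. \<eta> ^ j) \<longlonglongrightarrow> 1 / (1 - \<eta>)"
      using geometric_sums[of \<eta>] \<eta> by (simp add: sums_def)
  qed
  have pre: "B (\<lambda>k. \<Sum>i<m. U k ^ i) (2 ^ m)"
  proof (rule mono)
    show "B (\<lambda>k. \<Sum>i<m. U k ^ i) (\<Sum>i<m. 2 ^ i)"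
      by (intro finite_sum power_of BU) auto
    show "(\<Sum>i<m. 2 ^ i) \<le> (2::real) ^ m" by (simp add: sum_gp_strict)
  qed
  have "B (\<lambda>k. 1 / (1 + \<kappa>) * ((\<Sum>i<m. U k ^ i) * (1 / (1 - U k ^ m)))) (\<bar>1 / (1 + \<kappa>)\<bar> * (2 ^ m * (1 / (1 - \<eta>))))"
    by (intro scale mult pre inv)
  moreover have "1 / (1 + \<kappa>) * ((\<Sum>i<m. U k ^ i) * (1 / (1 - U k ^ m))) = 1 / (1 + \<kappa> * x ^ k)" for k
  proof -
    have "U k ^ m < 1" using U[of k] m by (simp add: power_less_one_iff)
    then have "(\<Sum>i<m. U k ^ i) * (1 / (1 - U k ^ m)) = 1 / (1 - U k)"
      using U[of k] by (simp add: sum_gp_strict)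
    moreover have "(1 + \<kappa>) * (1 - U k) = 1 + \<kappa> * x ^ k"
      using \<kappa> by (simp add: U_def field_simps)
    ultimately show ?thesis by (metis mult.right_neutral times_divide_times_eq)
  qed
  moreover have "\<bar>1 / (1 + \<kappa>)\<bar> * (2 ^ m * (1 / (1 - \<eta>))) \<le> 2 ^ m / (1 - \<eta>)"
  proof -
    have "\<bar>1 / (1 + \<kappa>)\<bar> * (2 ^ m * (1 / (1 - \<eta>))) \<le> 1 * (2 ^ m * (1 / (1 - \<eta>)))"
      using \<kappa> \<eta> by (intro mult_right_mono) auto
    then show ?thesis by simp
  qed
  ultimately show ?thesis unfolding \<eta>_def by (auto elim: mono)
qed

end

text \<open>
  The order of the quantifiers is essential: one constant \<open>K\<close> serves cubes of all dimensions.
\<close>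
theorem level_one_bound:
  fixes m :: nat and \<theta> :: real
  assumes m: "0 < m" and \<theta>: "0 \<le> \<theta>" "\<theta> < 1"
  shows "\<exists>K>0. \<forall>n B. level_multipliers n B \<longrightarrow>
      (\<forall>x. 0 \<le> x \<and> x \<le> 1 \<longrightarrow> B (\<lambda>k. (1 - x ^ k) ^ m) (\<theta> * 2 ^ m)) \<longrightarrow>
      B (\<lambda>k. if k = 1 then 1 else 0) K"
proof -
  have "eventually (\<lambda>\<kappa>. \<kappa> ^ m * \<theta> < 1) (at_right (1::real))"
  proof (rule order_tendstoD(2))
    show "((\<lambda>\<kappa>. \<kappa> ^ m * \<theta>) \<longlongrightarrow> 1 ^ m * \<theta>) (at_right (1::real))"
      by (intro tendsto_intros)
  qed (use \<theta> in auto)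
  then have "eventually (\<lambda>\<kappa>. 1 < \<kappa> \<and> \<kappa> ^ m * \<theta> < 1) (at_right (1::real))"
    by (intro eventually_conj) (auto simp: eventually_at_right_less)
  then obtain \<kappa> :: real where \<kappa>: "1 < \<kappa>" "\<kappa> ^ m * \<theta> < 1"
    using eventually_happens[of _ "at_right (1::real)"] by auto
  define C where "C = 2 ^ m / (1 - \<kappa> ^ m * \<theta>)"
  have "B (\<lambda>k. if k = 1 then 1 else 0) (max 1 (analytic_multipliers.level_one_const \<kappa> C))"
    if "level_multipliers n B" and d: "\<And>x. 0 \<le> x \<Longrightarrow> x \<le> 1 \<Longrightarrow> B (\<lambda>k. (1 - x ^ k) ^ m) (\<theta> * 2 ^ m)" for n B
  proof -
    interpret level_multipliers n B by fact
    interpret analytic_multipliers n B \<kappa> C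
    proof
      show "0 \<le> C" using \<kappa> by (simp add: C_def)
      show "B (\<lambda>k. 1 / (1 + \<kappa> * x ^ k)) C" if "0 \<le> x" "x \<le> 1" for x
        unfolding C_def by (intro neumann_inverse d that \<kappa> \<theta> m)
    qed (rule \<kappa>)
    show ?thesis by (rule mono[OF level_one]) simp
  qed
  then show ?thesis by (intro exI[of _ "max 1 (analytic_multipliers.level_one_const \<kappa> C)"]) auto
qed

section \<open>Convexity of powers and finite Lebesgue norms\<close>

lemma powr_mean_convex:
  fixes x y t q :: real
  assumes "1 \<le> q" "0 \<le> x" "0 \<le> y" "0 \<le> t" "t \<le> 1"
  shows "(t * x + (1 - t) * y) powr q \<le> t * x powr q + (1 - t) * y powr q"
proof -
  have small: "s powr q \<le> s" if "0 \<le> s" "s \<le> 1" for s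
    using powr_mono'[of 1 q s] that assms(1) by simp
  consider "x = 0" | "y = 0" | "0 < x" "0 < y" using assms by linarith
  then show ?thesis
  proof cases
    case 1
    have "((1 - t) * y) powr q = (1 - t) powr q * y powr q" using assms by (simp add: powr_mult)
    also have "\<dots> \<le> (1 - t) * y powr q" using assms by (intro mult_right_mono small) auto
    finally show ?thesis using 1 assms by simp
  next
    case 2
    have "(t * x) powr q = t powr q * x powr q" using assms by (simp add: powr_mult)
    also have "\<dots> \<le> t * x powr q" using assms by (intro mult_right_mono small) auto
    finally show ?thesis using 2 assms by simp
  next
    case 3
    then show ?thesis
      using convex_onD[OF powr_convex[OF assms(1)], of "1 - t" x y] assms by simp
  qed
qed

lemma sum_powr_le:
  fixes b :: "'i \<Rightarrow> real"
  assumes "finite J" "1 \<le> r" "\<And>j. j \<in> J \<Longrightarrow> 0 \<le> b j"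
  shows "(\<Sum>j\<in>J. b j) powr r \<le> real (card J) powr (r - 1) * (\<Sum>j\<in>J. b j powr r)"
  using assms(1,3)
proof (induction J rule: finite_induct)
  case empty
  then show ?case by simp
next
  case (insert i J)
  show ?case
  proof (cases "J = {}")
    case True
    then show ?thesis by simp
  next
    case False
    define m where "m = real (card J)"
    have m: "1 \<le> m" using insert False by (simp add: m_def Suc_le_eq card_gt_0_iff)
    define t where "t = 1 / (m + 1)"
    have t: "0 \<le> t" "t \<le> 1" "1 - t = m / (m + 1)" using m by (auto simp: t_def field_simps)
    define s where "s = (\<Sum>j\<in>J. b j)"
    have s: "0 \<le> s" using insert by (auto simp: s_def intro: sum_nonneg)
    have IH: "s powr r \<le> m powr (r - 1) * (\<Sum>j\<in>J. b j powr r)" using insert by (auto simp: s_def m_def)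
    have "t * b i + (1 - t) * (s / m) = (b i + s) / (m + 1)"
      unfolding t(3) using m by (simp add: t_def add_divide_distrib)
    then have "((b i + s) / (m + 1)) powr r \<le> t * b i powr r + (1 - t) * (s / m) powr r"
      using powr_mean_convex[of r "b i" "s / m" t] assms(2) t m s insert by simp
    also have "(s / m) powr r = s powr r / m powr r" using m s by (simp add: powr_divide)
    also have "t * b i powr r + (1 - t) * (s powr r / m powr r) \<le>
        t * b i powr r + (1 - t) * ((m powr (r - 1) * (\<Sum>j\<in>J. b j powr r)) / m powr r)"
      using IH t m by (intro add_left_mono mult_left_mono divide_right_mono) auto
    also have "(m powr (r - 1) * (\<Sum>j\<in>J. b j powr r)) / m powr r = (\<Sum>j\<in>J. b j powr r) / m"
      using m by (simp add: powr_diff)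
    also have "t * b i powr r + (1 - t) * ((\<Sum>j\<in>J. b j powr r) / m) = (b i powr r + (\<Sum>j\<in>J. b j powr r)) / (m + 1)"
      unfolding t(3) using m by (simp add: t_def add_divide_distrib)
    finally have "(b i + s) powr r / (m + 1) powr r \<le> (b i powr r + (\<Sum>j\<in>J. b j powr r)) / (m + 1)"
      using insert s m by (simp add: powr_divide)
    then have "(b i + s) powr r \<le> (m + 1) powr r * ((b i powr r + (\<Sum>j\<in>J. b j powr r)) / (m + 1))"
      using m by (simp add: field_simps)
    also have "\<dots> = (m + 1) powr (r - 1) * (b i powr r + (\<Sum>j\<in>J. b j powr r))"
      using m by (simp add: powr_diff)
    finally show ?thesis using insert by (simp add: m_def s_def add.commute)
  qed
qed

text \<open>
  The norm of \<open>L\<^sub>q\<close> with respect to counting measure; on a cube it differs from the normalised one by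
  a constant factor, which cancels in operator norms.
\<close>
definition lpnorm :: "real \<Rightarrow> 'w set \<Rightarrow> ('w \<Rightarrow> 'b::real_normed_vector) \<Rightarrow> real" where
  "lpnorm q \<Omega> F = (\<Sum>w\<in>\<Omega>. norm (F w) powr q) powr (1 / q)"

lemma lpnorm_nonneg [simp]: "0 \<le> lpnorm q \<Omega> F" by (simp add: lpnorm_def)

lemma lpnorm_powr: "0 < q \<Longrightarrow> lpnorm q \<Omega> F powr q = (\<Sum>w\<in>\<Omega>. norm (F w) powr q)"
  by (simp add: lpnorm_def powr_powr sum_nonneg)

lemma lpnorm_le_iff:
  assumes "0 < q" "0 \<le> c"
  shows "lpnorm q \<Omega> F \<le> c \<longleftrightarrow> (\<Sum>w\<in>\<Omega>. norm (F w) powr q) \<le> c powr q"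
proof -
  have "lpnorm q \<Omega> F \<le> c \<longleftrightarrow> lpnorm q \<Omega> F powr q \<le> c powr q"
    using assms powr_mono2[of q "lpnorm q \<Omega> F" c] powr_less_mono2[of q c "lpnorm q \<Omega> F"]
    by (smt (verit) lpnorm_nonneg)
  then show ?thesis using assms by (simp add: lpnorm_powr)
qed

lemma lpnorm_scale:
  assumes "0 < q"
  shows "lpnorm q \<Omega> (\<lambda>w. a *\<^sub>R F w) = \<bar>a\<bar> * lpnorm q \<Omega> F"
proof -
  have "(\<Sum>w\<in>\<Omega>. norm (a *\<^sub>R F w) powr q) = \<bar>a\<bar> powr q * (\<Sum>w\<in>\<Omega>. norm (F w) powr q)"
    by (simp add: powr_mult sum_distrib_left)
  then show ?thesis using assms by (simp add: lpnorm_def powr_mult powr_powr sum_nonneg)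
qed

text \<open>
  Minkowski's inequality: after normalising both functions, apply convexity of \<open>x \<mapsto> x\<^sup>q\<close> pointwise
  with the weights \<open>\<parallel>F\<parallel> / (\<parallel>F\<parallel> + \<parallel>G\<parallel>)\<close> and \<open>\<parallel>G\<parallel> / (\<parallel>F\<parallel> + \<parallel>G\<parallel>)\<close>.
\<close>
lemma lpnorm_triangle:
  assumes q: "1 \<le> q" and fin: "finite \<Omega>"
  shows "lpnorm q \<Omega> (\<lambda>w. F w + G w) \<le> lpnorm q \<Omega> F + lpnorm q \<Omega> G"
proof -
  define a b where "a = lpnorm q \<Omega> F" and "b = lpnorm q \<Omega> G"
  have zero: "\<forall>w\<in>\<Omega>. H w = 0" if "lpnorm q \<Omega> H = 0" for H :: "'a \<Rightarrow> 'b"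
  proof -
    have "(\<Sum>w\<in>\<Omega>. norm (H w) powr q) = 0"
      using that by (simp add: lpnorm_def)
    then show ?thesis using fin by (simp add: sum_nonneg_eq_0_iff)
  qed
  have cong: "lpnorm q \<Omega> H = lpnorm q \<Omega> H'" if "\<forall>w\<in>\<Omega>. H w = H' w" for H H' :: "'a \<Rightarrow> 'b"
    unfolding lpnorm_def using that by (intro arg_cong[of _ _ "\<lambda>x. x powr (1/q)"] sum.cong) auto
  have ab: "0 \<le> a" "0 \<le> b" by (auto simp: a_def b_def)
  consider "a = 0" | "b = 0" | "0 < a" "0 < b" using ab by linarith
  then show ?thesis
  proof cases
    case 1
    then have "lpnorm q \<Omega> (\<lambda>w. F w + G w) = b"
      unfolding b_def using zero[of F] by (intro cong) (auto simp: a_def)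
    then show ?thesis using ab by (simp add: a_def b_def)
  next
    case 2
    then have "lpnorm q \<Omega> (\<lambda>w. F w + G w) = a"
      unfolding a_def using zero[of G] by (intro cong) (auto simp: b_def)
    then show ?thesis using ab by (simp add: a_def b_def)
  next
    case 3
    define t where "t = a / (a + b)"
    have t: "0 \<le> t" "t \<le> 1" "1 - t = b / (a + b)" using 3 by (auto simp: t_def field_simps)
    have pw: "norm (F w + G w) powr q \<le>
        (a + b) powr q * (t * (norm (F w) powr q / a powr q) + (1 - t) * (norm (G w) powr q / b powr q))" for w
    proof -
      have "norm (F w + G w) powr q \<le> (norm (F w) + norm (G w)) powr q"
        using q by (intro powr_mono2 norm_triangle_ineq) auto
      also have "norm (F w) + norm (G w) = (a + b) * (t * (norm (F w) / a) + (1 - t) * (norm (G w) / b))"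
      proof -
        have "(a + b) * t = a" "(a + b) * (1 - t) = b" unfolding t(3) using 3 by (simp_all add: t_def)
        then have eq: "(a + b) * (t * x + (1 - t) * y) = a * x + b * y" for x y
          by (metis distrib_left mult.assoc)
        show ?thesis unfolding eq using 3 by simp
      qed
      also have "\<dots> powr q = (a + b) powr q * (t * (norm (F w) / a) + (1 - t) * (norm (G w) / b)) powr q"
        using 3 t by (simp add: powr_mult)
      also have "\<dots> \<le> (a + b) powr q * (t * (norm (F w) / a) powr q + (1 - t) * (norm (G w) / b) powr q)"
        using 3 t q by (intro mult_left_mono powr_mean_convex) auto
      finally show ?thesis using 3 by (simp add: powr_divide)
    qed
    have sa: "(\<Sum>w\<in>\<Omega>. norm (F w) powr q) = a powr q" "(\<Sum>w\<in>\<Omega>. norm (G w) powr q) = b powr q"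
      using q by (simp_all add: a_def b_def lpnorm_powr)
    have "(\<Sum>w\<in>\<Omega>. norm (F w + G w) powr q) \<le>
      (\<Sum>w\<in>\<Omega>. (a + b) powr q * (t * (norm (F w) powr q / a powr q) + (1 - t) * (norm (G w) powr q / b powr q)))"
      by (intro sum_mono pw)
    also have "\<dots> = (a + b) powr q * (t * ((\<Sum>w\<in>\<Omega>. norm (F w) powr q) / a powr q)
        + (1 - t) * ((\<Sum>w\<in>\<Omega>. norm (G w) powr q) / b powr q))"
      by (simp add: sum_distrib_left sum.distrib sum_divide_distrib distrib_left)
    also have "\<dots> = (a + b) powr q" unfolding sa using 3 by simp
    finally show ?thesis
      using 3 q by (subst lpnorm_le_iff) (auto simp: a_def b_def)
  qed
qed

section \<open>Walsh multipliers\<close>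

text \<open>
  A point of the discrete cube is given by the set of coordinates that carry the sign \<open>-1\<close>, so that
  points and Walsh functions are indexed by the same sets, and translations are symmetric differences.
\<close>
definition sgn_at :: "nat set \<Rightarrow> nat \<Rightarrow> real" where
  "sgn_at S i = (if i \<in> S then -1 else 1)"

definition walsh :: "nat set \<Rightarrow> nat set \<Rightarrow> real" where
  "walsh A S = (\<Prod>i\<in>A. sgn_at S i)"

definition walsh_sum :: "nat \<Rightarrow> (nat set \<Rightarrow> 'b::real_normed_vector) \<Rightarrow> nat set \<Rightarrow> 'b" where
  "walsh_sum n y S = (\<Sum>A\<in>Pow {..<n}. walsh A S *\<^sub>R y A)"

text \<open>
  The norm bound is stated in terms of families of Walsh coefficients instead of functions. Composing
  multipliers then amounts to substituting one family into the other.
\<close>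
definition walsh_bound :: "'b::real_normed_vector itself \<Rightarrow> real \<Rightarrow> nat \<Rightarrow> (nat set \<Rightarrow> real) \<Rightarrow> real \<Rightarrow> bool" where
  "walsh_bound _ q n g c \<longleftrightarrow> (\<forall>y :: nat set \<Rightarrow> 'b.
     lpnorm q (Pow {..<n}) (walsh_sum n (\<lambda>A. g A *\<^sub>R y A)) \<le> c * lpnorm q (Pow {..<n}) (walsh_sum n y))"

lemma walsh_sum_add: "walsh_sum n (\<lambda>A. y A + z A) S = walsh_sum n y S + walsh_sum n z S"
  by (simp add: walsh_sum_def scaleR_add_right sum.distrib)

lemma walsh_sum_scale: "walsh_sum n (\<lambda>A. a *\<^sub>R y A) S = a *\<^sub>R walsh_sum n y S"
  by (simp add: walsh_sum_def scaleR_sum_right mult.commute)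

lemma walsh_bound_add:
  assumes q: "1 \<le> q" and "walsh_bound TYPE('b::real_normed_vector) q n g c" "walsh_bound TYPE('b) q n h d"
  shows "walsh_bound TYPE('b) q n (\<lambda>A. g A + h A) (c + d)"
  unfolding walsh_bound_def
proof
  fix y :: "nat set \<Rightarrow> 'b"
  have "lpnorm q (Pow {..<n}) (walsh_sum n (\<lambda>A. (g A + h A) *\<^sub>R y A)) =
      lpnorm q (Pow {..<n}) (\<lambda>S. walsh_sum n (\<lambda>A. g A *\<^sub>R y A) S + walsh_sum n (\<lambda>A. h A *\<^sub>R y A) S)"
    by (simp add: scaleR_add_left walsh_sum_add[symmetric])
  also have "\<dots> \<le> lpnorm q (Pow {..<n}) (walsh_sum n (\<lambda>A. g A *\<^sub>R y A)) + lpnorm q (Pow {..<n}) (walsh_sum n (\<lambda>A. h A *\<^sub>R y A))"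
    by (intro lpnorm_triangle q) auto
  also have "\<dots> \<le> c * lpnorm q (Pow {..<n}) (walsh_sum n y) + d * lpnorm q (Pow {..<n}) (walsh_sum n y)"
    using assms by (intro add_mono) (auto simp: walsh_bound_def)
  finally show "lpnorm q (Pow {..<n}) (walsh_sum n (\<lambda>A. (g A + h A) *\<^sub>R y A)) \<le> (c + d) * lpnorm q (Pow {..<n}) (walsh_sum n y)"
    by (simp add: distrib_right)
qed

lemma walsh_bound_scale:
  assumes q: "1 \<le> q" and "walsh_bound TYPE('b::real_normed_vector) q n g c"
  shows "walsh_bound TYPE('b) q n (\<lambda>A. a * g A) (\<bar>a\<bar> * c)"
  unfolding walsh_bound_def
proof
  fix y :: "nat set \<Rightarrow> 'b"
  have "lpnorm q (Pow {..<n}) (walsh_sum n (\<lambda>A. (a * g A) *\<^sub>R y A)) =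
      lpnorm q (Pow {..<n}) (\<lambda>S. a *\<^sub>R walsh_sum n (\<lambda>A. g A *\<^sub>R y A) S)"
    by (simp add: walsh_sum_scale[symmetric])
  also have "\<dots> = \<bar>a\<bar> * lpnorm q (Pow {..<n}) (walsh_sum n (\<lambda>A. g A *\<^sub>R y A))"
    using q by (intro lpnorm_scale) auto
  also have "\<dots> \<le> \<bar>a\<bar> * (c * lpnorm q (Pow {..<n}) (walsh_sum n y))"
    using assms by (intro mult_left_mono) (auto simp: walsh_bound_def)
  finally show "lpnorm q (Pow {..<n}) (walsh_sum n (\<lambda>A. (a * g A) *\<^sub>R y A)) \<le> (\<bar>a\<bar> * c) * lpnorm q (Pow {..<n}) (walsh_sum n y)"
    by (simp add: mult_ac)
qed

lemma walsh_bound_mono: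
  assumes "walsh_bound TYPE('b::real_normed_vector) q n g c" "c \<le> d"
  shows "walsh_bound TYPE('b) q n g d"
  unfolding walsh_bound_def
proof
  fix y :: "nat set \<Rightarrow> 'b"
  have "lpnorm q (Pow {..<n}) (walsh_sum n (\<lambda>A. g A *\<^sub>R y A)) \<le> c * lpnorm q (Pow {..<n}) (walsh_sum n y)"
    using assms by (simp add: walsh_bound_def)
  also have "\<dots> \<le> d * lpnorm q (Pow {..<n}) (walsh_sum n y)"
    using assms by (intro mult_right_mono) auto
  finally show "lpnorm q (Pow {..<n}) (walsh_sum n (\<lambda>A. g A *\<^sub>R y A)) \<le> d * lpnorm q (Pow {..<n}) (walsh_sum n y)" .
qed

lemma walsh_bound_one: "walsh_bound TYPE('b::real_normed_vector) q n (\<lambda>A. 1) 1"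
  by (simp add: walsh_bound_def)

lemma walsh_bound_const:
  assumes "1 \<le> q" "\<bar>a\<bar> \<le> c"
  shows "walsh_bound TYPE('b::real_normed_vector) q n (\<lambda>A. a) c"
  using walsh_bound_mono[OF walsh_bound_scale[OF assms(1) walsh_bound_one, of _ a]] assms(2) by simp

lemma walsh_bound_mult:
  assumes g: "walsh_bound TYPE('b::real_normed_vector) q n g c" and h: "walsh_bound TYPE('b) q n h d"
    and c: "0 \<le> c"
  shows "walsh_bound TYPE('b) q n (\<lambda>A. g A * h A) (c * d)"
  unfolding walsh_bound_def
proof
  fix y :: "nat set \<Rightarrow> 'b"
  have "lpnorm q (Pow {..<n}) (walsh_sum n (\<lambda>A. (g A * h A) *\<^sub>R y A)) \<le>
      c * lpnorm q (Pow {..<n}) (walsh_sum n (\<lambda>A. h A *\<^sub>R y A))"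
    using g[unfolded walsh_bound_def, rule_format, of "\<lambda>A. h A *\<^sub>R y A"] by simp
  also have "\<dots> \<le> c * (d * lpnorm q (Pow {..<n}) (walsh_sum n y))"
    using h c by (intro mult_left_mono) (auto simp: walsh_bound_def)
  finally show "lpnorm q (Pow {..<n}) (walsh_sum n (\<lambda>A. (g A * h A) *\<^sub>R y A)) \<le> (c * d) * lpnorm q (Pow {..<n}) (walsh_sum n y)"
    by (simp add: mult_ac)
qed

lemma walsh_bound_sum:
  assumes q: "1 \<le> q" and "finite I" and "\<And>i. i \<in> I \<Longrightarrow> walsh_bound TYPE('b::real_normed_vector) q n (g i) (c i)"
  shows "walsh_bound TYPE('b) q n (\<lambda>A. \<Sum>i\<in>I. g i A) (\<Sum>i\<in>I. c i)"
  using assms(2,3)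
proof (induction I rule: finite_induct)
  case empty
  then show ?case using walsh_bound_const[OF q, of 0 0] by simp
next
  case (insert i I)
  then show ?case using walsh_bound_add[OF q, of n "g i" "c i", where 'b = 'b] by simp
qed

lemma walsh_bound_limit:
  assumes q: "1 \<le> q" and b: "\<And>i::nat. walsh_bound TYPE('b::real_normed_vector) q n (gs i) (cs i)"
    and g: "\<And>A. A \<subseteq> {..<n} \<Longrightarrow> (\<lambda>i. gs i A) \<longlonglongrightarrow> g A" and c: "cs \<longlonglongrightarrow> c"
  shows "walsh_bound TYPE('b) q n g c"
  unfolding walsh_bound_def
proof
  fix y :: "nat set \<Rightarrow> 'b"
  show "lpnorm q (Pow {..<n}) (walsh_sum n (\<lambda>A. g A *\<^sub>R y A)) \<le> c * lpnorm q (Pow {..<n}) (walsh_sum n y)"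
  proof (rule tendsto_le[OF sequentially_bot])
    show "(\<lambda>i. cs i * lpnorm q (Pow {..<n}) (walsh_sum n y)) \<longlonglongrightarrow> c * lpnorm q (Pow {..<n}) (walsh_sum n y)"
      by (intro tendsto_intros c)
    have "(\<lambda>i. walsh_sum n (\<lambda>A. gs i A *\<^sub>R y A) S) \<longlonglongrightarrow> walsh_sum n (\<lambda>A. g A *\<^sub>R y A) S" for S
      unfolding walsh_sum_def by (intro tendsto_intros g) auto
    then show "(\<lambda>i. lpnorm q (Pow {..<n}) (walsh_sum n (\<lambda>A. gs i A *\<^sub>R y A))) \<longlonglongrightarrow>
        lpnorm q (Pow {..<n}) (walsh_sum n (\<lambda>A. g A *\<^sub>R y A))"
      unfolding lpnorm_def using q
      by (intro tendsto_powr' tendsto_sum tendsto_norm tendsto_const)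
         (auto intro!: sum_nonneg always_eventually)
    show "eventually (\<lambda>i. lpnorm q (Pow {..<n}) (walsh_sum n (\<lambda>A. gs i A *\<^sub>R y A)) \<le>
        cs i * lpnorm q (Pow {..<n}) (walsh_sum n y)) sequentially"
      using b by (auto simp: walsh_bound_def)
  qed
qed

section \<open>Averages of translations\<close>

lemma walsh_as_prod:
  assumes "finite A" "finite I" "V \<subseteq> I" "A \<subseteq> I"
  shows "walsh A V = (\<Prod>i\<in>V. if i \<in> A then -1 else 1)"
proof -
  have "walsh A V = (\<Prod>i\<in>I. if i \<in> A \<and> i \<in> V then -1 else 1)"
    unfolding walsh_def sgn_at_def using assms
    by (intro prod.mono_neutral_cong_left) auto
  also have "\<dots> = (\<Prod>i\<in>V. if i \<in> A then -1 else 1)"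
    using assms by (intro prod.mono_neutral_cong_right) auto
  finally show ?thesis .
qed

lemma sgn_at_sym_diff: "sgn_at (sym_diff S V) i = sgn_at S i * sgn_at V i"
  by (auto simp: sgn_at_def)

lemma walsh_sym_diff: "walsh A (sym_diff S V) = walsh A S * walsh A V"
  by (simp add: walsh_def sgn_at_sym_diff prod.distrib)

lemma sum_sym_diff:
  fixes h :: "'i set \<Rightarrow> 'c::comm_monoid_add"
  assumes "V \<subseteq> I"
  shows "(\<Sum>S\<in>Pow I. h (sym_diff S V)) = (\<Sum>S\<in>Pow I. h S)"
  by (rule sum.reindex_bij_witness[of _ "\<lambda>S. sym_diff S V" "\<lambda>S. sym_diff S V"]) (use assms in auto)

text \<open>
  Multiplying the coefficients by \<open>walsh A V\<close> translates the function by \<open>V\<close>, a permutation of the cube.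
\<close>
lemma walsh_bound_translation:
  assumes "V \<subseteq> {..<n}"
  shows "walsh_bound TYPE('b::real_normed_vector) q n (\<lambda>A. walsh A V) 1"
  unfolding walsh_bound_def
proof
  fix y :: "nat set \<Rightarrow> 'b"
  have "walsh_sum n (\<lambda>A. walsh A V *\<^sub>R y A) S = walsh_sum n y (sym_diff S V)" for S
    by (simp add: walsh_sum_def walsh_sym_diff)
  then show "lpnorm q (Pow {..<n}) (walsh_sum n (\<lambda>A. walsh A V *\<^sub>R y A)) \<le> 1 * lpnorm q (Pow {..<n}) (walsh_sum n y)"
    unfolding lpnorm_def using sum_sym_diff[OF assms, of "\<lambda>S. norm (walsh_sum n y S) powr q"] by simp
qed

lemma walsh_bound_cong:
  assumes "walsh_bound TYPE('b::real_normed_vector) q n g c" "\<And>A. A \<subseteq> {..<n} \<Longrightarrow> g A = h A"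
  shows "walsh_bound TYPE('b) q n h c"
proof -
  have "walsh_sum n (\<lambda>A. g A *\<^sub>R y A) = walsh_sum n (\<lambda>A. h A *\<^sub>R y A)" for y :: "nat set \<Rightarrow> 'b"
    unfolding walsh_sum_def using assms(2) by (intro ext sum.cong) auto
  then show ?thesis using assms(1) by (simp add: walsh_bound_def)
qed

text \<open>
  If the elements of \<open>V\<close> are chosen independently, \<open>i\<close> with probability \<open>(1 - a\<^sub>i) / 2\<close>, then the
  sign at \<open>i\<close> has mean \<open>a\<^sub>i\<close>, and \<open>walsh A V\<close> is a product of independent signs.
\<close>
lemma prod_as_walsh_average:
  fixes a :: "nat \<Rightarrow> real"
  assumes "finite I" "A \<subseteq> I"
  shows "(\<Sum>V\<in>Pow I. ((\<Prod>i\<in>V. (1 - a i) / 2) * (\<Prod>i\<in>I - V. (1 + a i) / 2)) * walsh A V) = (\<Prod>i\<in>A. a i)"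
proof -
  have "(\<Sum>V\<in>Pow I. ((\<Prod>i\<in>V. (1 - a i) / 2) * (\<Prod>i\<in>I - V. (1 + a i) / 2)) * walsh A V) =
      (\<Sum>V\<in>Pow I. (\<Prod>i\<in>V. (1 - a i) / 2 * (if i \<in> A then -1 else 1)) * (\<Prod>i\<in>I - V. (1 + a i) / 2))"
  proof (rule sum.cong)
    fix V assume "V \<in> Pow I"
    then have w: "walsh A V = (\<Prod>i\<in>V. if i \<in> A then -1 else 1)"
      using assms finite_subset[OF assms(2)] by (intro walsh_as_prod[of A I]) auto
    show "((\<Prod>i\<in>V. (1 - a i) / 2) * (\<Prod>i\<in>I - V. (1 + a i) / 2)) * walsh A V =
        (\<Prod>i\<in>V. (1 - a i) / 2 * (if i \<in> A then -1 else 1)) * (\<Prod>i\<in>I - V. (1 + a i) / 2)"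
      unfolding w prod.distrib by (simp only: mult_ac)
  qed simp
  also have "\<dots> = (\<Prod>i\<in>I. (1 - a i) / 2 * (if i \<in> A then -1 else 1) + (1 + a i) / 2)"
    by (rule prod_add[symmetric]) fact
  also have "\<dots> = (\<Prod>i\<in>A. a i)"
    using assms by (intro prod.mono_neutral_cong_right) (auto simp: field_simps)
  finally show ?thesis .
qed

text \<open>
  For \<open>\<bar>a\<^sub>i\<bar> \<le> 1\<close> the weights in \<open>prod_as_walsh_average\<close> are probabilities, so the multiplier is an
  average of translations. Noise operators, conditional expectations and the contraction principle
  are all instances.
\<close>
lemma walsh_bound_prod:
  assumes q: "1 \<le> q" and a: "\<And>i. i < n \<Longrightarrow> \<bar>a i\<bar> \<le> 1"
  shows "walsh_bound TYPE('b::real_normed_vector) q n (\<lambda>A. \<Prod>i\<in>A. a i) 1"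
proof -
  define p where "p V = (\<Prod>i\<in>V. (1 - a i) / 2) * (\<Prod>i\<in>{..<n} - V. (1 + a i) / 2)" for V
  have p: "0 \<le> p V" if "V \<subseteq> {..<n}" for V
  proof -
    have "0 \<le> (1 - a i) / 2" "0 \<le> (1 + a i) / 2" if "i < n" for i
      using a[OF that] by auto
    then show ?thesis unfolding p_def using that by (intro mult_nonneg_nonneg prod_nonneg) auto
  qed
  have "(\<Sum>V\<in>Pow {..<n}. p V) = 1"
    using prod_as_walsh_average[of "{..<n}" "{}" a] by (simp add: p_def walsh_def)
  then have "(\<Sum>V\<in>Pow {..<n}. \<bar>p V\<bar> * 1) = 1"
    using p by simp
  moreover have "walsh_bound TYPE('b) q n (\<lambda>A. \<Sum>V\<in>Pow {..<n}. p V * walsh A V) (\<Sum>V\<in>Pow {..<n}. \<bar>p V\<bar> * 1)"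
    by (intro walsh_bound_sum walsh_bound_scale walsh_bound_translation q) auto
  ultimately have "walsh_bound TYPE('b) q n (\<lambda>A. \<Sum>V\<in>Pow {..<n}. p V * walsh A V) 1" by simp
  then show ?thesis
    by (rule walsh_bound_cong) (simp add: p_def prod_as_walsh_average)
qed

text \<open>
  The multiplier is the conditional expectation given the coordinates in \<open>R\<close>.
\<close>
lemma walsh_bound_cond_exp:
  assumes q: "1 \<le> q"
  shows "walsh_bound TYPE('b::real_normed_vector) q n (\<lambda>A. of_bool (A \<subseteq> R)) 1"
proof -
  have "walsh_bound TYPE('b) q n (\<lambda>A. \<Prod>i\<in>A. of_bool (i \<in> R)) 1"
    by (rule walsh_bound_prod[OF q]) auto
  then show ?thesis
  proof (rule walsh_bound_cong)
    fix A assume "A \<subseteq> {..<n}"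
    then have "finite A" using finite_subset by blast
    then show "(\<Prod>i\<in>A. of_bool (i \<in> R)) = (of_bool (A \<subseteq> R) :: real)"
      by (auto simp: of_bool_def subset_iff)
  qed
qed

text \<open>
  Keep each coordinate independently with probability \<open>x\<close>: all coordinates of \<open>A\<close> are kept with
  probability \<open>x ^ card A\<close>.
\<close>
lemma noise_as_cond_exp_average:
  fixes x :: real
  assumes "finite I" "A \<subseteq> I"
  shows "(\<Sum>V\<in>Pow I. x ^ card V * (1 - x) ^ card (I - V) * of_bool (A \<subseteq> V)) = x ^ card A"
proof -
  have fA: "finite A" using assms finite_subset by blast
  have "(\<Sum>V\<in>Pow I. x ^ card V * (1 - x) ^ card (I - V) * of_bool (A \<subseteq> V)) =
    (\<Sum>V\<in>Pow I. (\<Prod>i\<in>V. x) * (\<Prod>i\<in>I - V. (1 - x) * of_bool (i \<notin> A)))"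
  proof (rule sum.cong)
    fix V assume "V \<in> Pow I"
    then have "(\<Prod>i\<in>I - V. of_bool (i \<notin> A)) = (of_bool (A \<subseteq> V) :: real)"
      using assms by (cases "A \<subseteq> V") (auto intro!: prod.neutral)
    then show "x ^ card V * (1 - x) ^ card (I - V) * of_bool (A \<subseteq> V) =
        (\<Prod>i\<in>V. x) * (\<Prod>i\<in>I - V. (1 - x) * of_bool (i \<notin> A))"
      by (simp add: prod.distrib)
  qed simp
  also have "\<dots> = (\<Prod>i\<in>I. x + (1 - x) * of_bool (i \<notin> A))"
    by (rule prod_add[symmetric]) fact
  also have "\<dots> = (\<Prod>i\<in>A. x)"
    using assms by (intro prod.mono_neutral_cong_right) auto
  finally show ?thesis by simp
qed

text \<open>
  Each of the \<open>m\<close> factors \<open>1 - x ^ card A\<close> is an average over \<open>V\<close> of the factors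
  \<open>1 - of_bool (A \<subseteq> V)\<close>. They are replaced one at a time, and every replacement is a convex combination.
\<close>
lemma noise_difference_bound:
  assumes q: "1 \<le> q" and x: "0 \<le> x" "x \<le> 1"
    and c: "\<And>R. walsh_bound TYPE('b::real_normed_vector) q n (\<lambda>A. \<Prod>i<m. 1 - of_bool (A \<subseteq> R i)) c"
  shows "walsh_bound TYPE('b) q n (\<lambda>A. (1 - x ^ card A) ^ m) c"
proof -
  define p where "p V = x ^ card V * (1 - x) ^ card ({..<n} - V)" for V :: "nat set"
  have p: "0 \<le> p V" for V using x by (simp add: p_def)
  have p1: "(\<Sum>V\<in>Pow {..<n}. p V) = 1"
    using noise_as_cond_exp_average[of "{..<n}" "{}" x] by (simp add: p_def)
  have factor: "(\<Sum>V\<in>Pow {..<n}. p V * ((1 - e V) * P)) =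
      ((\<Sum>V\<in>Pow {..<n}. p V) - (\<Sum>V\<in>Pow {..<n}. p V * e V)) * P" for e :: "nat set \<Rightarrow> real" and P
    unfolding sum_subtractf[symmetric] sum_distrib_right
    by (intro sum.cong) (auto simp: algebra_simps)
  have "\<forall>R. walsh_bound TYPE('b) q n (\<lambda>A. (\<Prod>i<j. 1 - of_bool (A \<subseteq> R i)) * (1 - x ^ card A) ^ (m - j)) c"
    if "j \<le> m" for j
    using that
  proof (induction j rule: inc_induct)
    case base
    then show ?case using c by simp
  next
    case (step j)
    show ?case
    proof
      fix R :: "nat \<Rightarrow> nat set"
      let ?g = "\<lambda>V A. (\<Prod>i<Suc j. 1 - of_bool (A \<subseteq> (R(j := V)) i)) * (1 - x ^ card A) ^ (m - Suc j)"
      have "walsh_bound TYPE('b) q n (\<lambda>A. \<Sum>V\<in>Pow {..<n}. p V * ?g V A) (\<Sum>V\<in>Pow {..<n}. \<bar>p V\<bar> * c)"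
        using step.IH by (intro walsh_bound_sum walsh_bound_scale q) blast+
      moreover have "(\<Sum>V\<in>Pow {..<n}. \<bar>p V\<bar> * c) = c"
        using p p1 by (simp flip: sum_distrib_right)
      ultimately have "walsh_bound TYPE('b) q n (\<lambda>A. \<Sum>V\<in>Pow {..<n}. p V * ?g V A) c" by simp
      then show "walsh_bound TYPE('b) q n (\<lambda>A. (\<Prod>i<j. 1 - of_bool (A \<subseteq> R i)) * (1 - x ^ card A) ^ (m - j)) c"
      proof (rule walsh_bound_cong)
        fix A assume A: "A \<subseteq> {..<n}"
        let ?P = "(\<Prod>i<j. 1 - of_bool (A \<subseteq> R i)) * (1 - x ^ card A) ^ (m - Suc j)"
        have "(\<Sum>V\<in>Pow {..<n}. p V * ?g V A) = (\<Sum>V\<in>Pow {..<n}. p V * ((1 - of_bool (A \<subseteq> V)) * ?P))"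
          by (intro sum.cong) (auto simp: mult_ac)
        also have "\<dots> = ((\<Sum>V\<in>Pow {..<n}. p V) - (\<Sum>V\<in>Pow {..<n}. p V * of_bool (A \<subseteq> V))) * ?P"
          by (rule factor)
        also have "\<dots> = (1 - x ^ card A) * ?P"
          using noise_as_cond_exp_average[OF _ A, of x] p1 by (simp add: p_def)
        also have "\<dots> = (\<Prod>i<j. 1 - of_bool (A \<subseteq> R i)) * (1 - x ^ card A) ^ (m - j)"
          using step.hyps by (simp add: Suc_diff_Suc[symmetric] mult_ac)
        finally show "(\<Sum>V\<in>Pow {..<n}. p V * ?g V A) =
           (\<Prod>i<j. 1 - of_bool (A \<subseteq> R i)) * (1 - x ^ card A) ^ (m - j)" .
      qed
    qed
  qed
  from this[of 0] show ?thesis by simp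
qed

lemma level_multipliers_walsh:
  assumes q: "1 \<le> q"
  shows "level_multipliers n (\<lambda>g c. walsh_bound TYPE('b::real_normed_vector) q n (\<lambda>A. g (card A)) c \<and> 0 \<le> c)"
proof
  fix gs :: "nat \<Rightarrow> nat \<Rightarrow> real" and g cs c
  assume b: "\<And>i. walsh_bound TYPE('b) q n (\<lambda>A. gs i (card A)) (cs i) \<and> 0 \<le> cs i"
    and l: "\<And>k. k \<le> n \<Longrightarrow> (\<lambda>i. gs i k) \<longlonglongrightarrow> g k" and c: "cs \<longlonglongrightarrow> c"
  have "walsh_bound TYPE('b) q n (\<lambda>A. g (card A)) c"
  proof (rule walsh_bound_limit[OF q _ _ c])
    show "(\<lambda>i. gs i (card A)) \<longlonglongrightarrow> g (card A)" if "A \<subseteq> {..<n}" for A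
      using l card_mono[OF _ that] by simp
  qed (use b in blast)
  moreover have "0 \<le> c" using c b by (intro LIMSEQ_le_const[OF c]) auto
  ultimately show "walsh_bound TYPE('b) q n (\<lambda>A. g (card A)) c \<and> 0 \<le> c" by blast
next
  fix x :: real assume "0 \<le> x" "x \<le> 1"
  then show "walsh_bound TYPE('b) q n (\<lambda>A. x ^ card A) 1 \<and> (0::real) \<le> 1"
    using walsh_bound_prod[OF q, of n "\<lambda>_. x"] by simp
qed (use walsh_bound_add[OF q] walsh_bound_mult walsh_bound_const[OF q] in \<open>auto intro: order_trans[OF abs_ge_zero]\<close>)

section \<open>Type and the Rademacher projection\<close>

lemma sign_expectation_eq:
  assumes "\<And>e e'. (\<And>j. j < n \<Longrightarrow> e j = e' j) \<Longrightarrow> F e = F e'"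
  shows "sign_expectation n F = (\<Sum>S\<in>Pow {..<n}. F (sgn_at S)) / 2 ^ n"
proof -
  let ?P = "{..<n} \<rightarrow>\<^sub>E {-1, 1::real}"
  have fin: "finite ?P" by (intro finite_PiE) auto
  have ne: "?P \<noteq> {}" by (simp add: PiE_eq_empty_iff)
  have card: "card ?P = 2 ^ n" by (simp add: card_PiE numeral_2_eq_2)
  have "sign_expectation n F = (\<Sum>e\<in>?P. F e) / card ?P"
    unfolding sign_expectation_def by (rule integral_pmf_of_set) fact+
  also have "(\<Sum>e\<in>?P. F e) = (\<Sum>S\<in>Pow {..<n}. F (sgn_at S))"
  proof (rule sum.reindex_bij_witness[of _ "\<lambda>S. restrict (sgn_at S) {..<n}" "\<lambda>e. {j. j < n \<and> e j = -1}"])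
    fix e assume e: "e \<in> ?P"
    have *: "sgn_at {j. j < n \<and> e j = -1} j = e j" if "j < n" for j
      using e that by (auto simp: sgn_at_def PiE_iff)
    show "restrict (sgn_at {j. j < n \<and> e j = -1}) {..<n} = e"
    proof
      fix j show "restrict (sgn_at {j. j < n \<and> e j = -1}) {..<n} j = e j"
        using * e by (cases "j < n") (auto simp: PiE_iff extensional_def)
    qed
    show "F (sgn_at {j. j < n \<and> e j = -1}) = F e" by (rule assms) (rule *)
  qed (auto simp: sgn_at_def)
  finally show ?thesis by (simp add: card)
qed

lemma sign_expectation_norm_sum:
  "sign_expectation n (\<lambda>e. norm (\<Sum>j<n. e j *\<^sub>R x j) powr p)
     = (\<Sum>S\<in>Pow {..<n}. norm (\<Sum>j<n. sgn_at S j *\<^sub>R x j) powr p) / 2 ^ n"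
  by (rule sign_expectation_eq) (metis (mono_tags, lifting) lessThan_iff sum.cong)

lemma sum_powr_interpolation:
  fixes b :: "nat \<Rightarrow> real"
  assumes p: "1 \<le> p" "p \<le> q" and b: "\<And>j. 0 \<le> b j" and m: "0 < m"
  shows "(\<Sum>j<m. b j) powr (q - p) * (\<Sum>j<m. b j powr p) \<le> real m powr (q - p) * (\<Sum>j<m. b j powr q)"
proof -
  define s where "s = (\<Sum>j<m. b j powr q)"
  have s: "0 \<le> s" by (simp add: s_def sum_nonneg)
  have b1: "(\<Sum>j<m. b j) \<le> (real m powr (q - 1) * s) powr (1 / q)"
  proof -
    have "(\<Sum>j<m. b j) = ((\<Sum>j<m. b j) powr q) powr (1 / q)"
      using p b by (simp add: powr_powr sum_nonneg)
    also have "\<dots> \<le> (real m powr (q - 1) * s) powr (1 / q)"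
      using sum_powr_le[of "{..<m}" q b] p b by (intro powr_mono2) (auto simp: s_def)
    finally show ?thesis .
  qed
  have b2: "(\<Sum>j<m. b j powr p) \<le> (real m powr (q / p - 1) * s) powr (p / q)"
  proof -
    have "(\<Sum>j<m. b j powr p) = ((\<Sum>j<m. b j powr p) powr (q / p)) powr (p / q)"
      using p by (simp add: powr_powr sum_nonneg)
    also have "\<dots> \<le> (real m powr (q / p - 1) * s) powr (p / q)"
      using sum_powr_le[of "{..<m}" "q / p" "\<lambda>j. b j powr p"] p
      by (intro powr_mono2) (auto simp: s_def powr_powr)
    finally show ?thesis .
  qed
  have "(\<Sum>j<m. b j) powr (q - p) * (\<Sum>j<m. b j powr p) \<le>
     ((real m powr (q - 1) * s) powr (1 / q)) powr (q - p) * (real m powr (q / p - 1) * s) powr (p / q)"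
    using p b b1 b2 by (intro mult_mono powr_mono2) (auto intro!: sum_nonneg)
  also have "\<dots> = (real m powr ((q - 1) * (q - p) / q) * real m powr ((q / p - 1) * (p / q)))
       * (s powr ((q - p) / q) * s powr (p / q))"
    using s by (simp add: powr_mult powr_powr)
  also have "real m powr ((q - 1) * (q - p) / q) * real m powr ((q / p - 1) * (p / q)) = real m powr (q - p)"
  proof -
    have "(q - 1) * (q - p) / q + (q / p - 1) * (p / q) = q - p"
      using p by (simp add: field_simps)
    then show ?thesis by (simp flip: powr_add)
  qed
  also have "s powr ((q - p) / q) * s powr (p / q) = s"
  proof -
    have "(q - p) / q + p / q = 1" using p by (simp add: field_simps)
    then have "s powr ((q - p) / q) * s powr (p / q) = s powr 1" by (simp flip: powr_add)
    then show ?thesis using s by simp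
  qed
  finally show ?thesis by (simp add: s_def)
qed

definition type_estimate :: "'b::real_normed_vector itself \<Rightarrow> real \<Rightarrow> real \<Rightarrow> bool" where
  "type_estimate _ p M \<longleftrightarrow> 0 < M \<and> (\<forall>m (x :: nat \<Rightarrow> 'b).
     (\<Sum>S\<in>Pow {..<m}. norm (\<Sum>j<m. sgn_at S j *\<^sub>R x j) powr p) / 2 ^ m \<le> M * (\<Sum>j<m. norm (x j) powr p))"

text \<open>
  Type \<open>p\<close> concerns the \<open>p\<close>-th moment, while the projection has to be bounded in \<open>L\<^sub>q\<close>. The trivial
  bound \<open>\<parallel>\<Sum>\<epsilon>\<^sub>j x\<^sub>j\<parallel> \<le> \<Sum>\<parallel>x\<^sub>j\<parallel>\<close> for the remaining \<open>q - p\<close> powers still leaves a gain of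
  \<open>m\<^sup>1\<^sup>-\<^sup>p\<close> against the trivial estimate \<open>m\<^sup>q\<^sup>-\<^sup>1 \<Sum>\<parallel>x\<^sub>j\<parallel>\<^sup>q\<close>, which is enough and avoids
  comparing moments of signed sums.
\<close>
lemma type_estimate_higher_moment:
  assumes T: "type_estimate TYPE('b::real_normed_vector) p M" and p: "1 \<le> p" "p \<le> q" and m: "0 < m"
  shows "(\<Sum>S\<in>Pow {..<m}. norm (\<Sum>j<m. sgn_at S j *\<^sub>R x j) powr q) / 2 ^ m
      \<le> M * (real m powr (q - p) * (\<Sum>j<m. norm (x j :: 'b) powr q))"
proof -
  let ?N = "\<Sum>j<m. norm (x j)"
  have pw: "norm (\<Sum>j<m. sgn_at S j *\<^sub>R x j) powr q \<le> ?N powr (q - p) * norm (\<Sum>j<m. sgn_at S j *\<^sub>R x j) powr p" for S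
  proof -
    have "norm (\<Sum>j<m. sgn_at S j *\<^sub>R x j) \<le> (\<Sum>j<m. norm (sgn_at S j *\<^sub>R x j))" by (rule norm_sum)
    also have "\<dots> = ?N" by (intro sum.cong) (auto simp: sgn_at_def)
    finally have "norm (\<Sum>j<m. sgn_at S j *\<^sub>R x j) powr (q - p) \<le> ?N powr (q - p)"
      using p by (intro powr_mono2) auto
    then have "norm (\<Sum>j<m. sgn_at S j *\<^sub>R x j) powr (q - p) * norm (\<Sum>j<m. sgn_at S j *\<^sub>R x j) powr p
        \<le> ?N powr (q - p) * norm (\<Sum>j<m. sgn_at S j *\<^sub>R x j) powr p"
      by (intro mult_right_mono) auto
    then show ?thesis by (simp flip: powr_add)
  qed
  have "(\<Sum>S\<in>Pow {..<m}. norm (\<Sum>j<m. sgn_at S j *\<^sub>R x j) powr q) / 2 ^ m \<le>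
     (\<Sum>S\<in>Pow {..<m}. ?N powr (q - p) * norm (\<Sum>j<m. sgn_at S j *\<^sub>R x j) powr p) / 2 ^ m"
    by (intro divide_right_mono sum_mono pw) auto
  also have "\<dots> = ?N powr (q - p) * ((\<Sum>S\<in>Pow {..<m}. norm (\<Sum>j<m. sgn_at S j *\<^sub>R x j) powr p) / 2 ^ m)"
    by (simp add: sum_distrib_left)
  also have "\<dots> \<le> ?N powr (q - p) * (M * (\<Sum>j<m. norm (x j) powr p))"
    using T unfolding type_estimate_def by (intro mult_left_mono) auto
  also have "\<dots> = M * (?N powr (q - p) * (\<Sum>j<m. norm (x j) powr p))" by (simp add: mult_ac)
  also have "\<dots> \<le> M * (real m powr (q - p) * (\<Sum>j<m. norm (x j) powr q))"
    using sum_powr_interpolation[OF p _ m, of "\<lambda>j. norm (x j)"] T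
    by (intro mult_left_mono) (auto simp: type_estimate_def)
  finally show ?thesis .
qed

text \<open>
  Functions with values in a space of type \<open>p > 1\<close> do not span \<open>\<ell>\<^sub>1\<close> in dimension \<open>m\<close> if \<open>m\<close> is large:
  some choice of signs beats the triangle inequality by a factor \<open>2\<close>. Averaging the pointwise estimate
  over the signs produces the choice.
\<close>
lemma exists_small_signed_sum:
  fixes F :: "nat \<Rightarrow> 'w \<Rightarrow> 'b::real_normed_vector"
  assumes T: "type_estimate TYPE('b) p M" and p: "1 \<le> p" "p \<le> q" and m: "0 < m"
    and large: "M * 2 powr q \<le> real m powr (p - 1)"
    and fin: "finite \<Omega>" and N: "\<And>j. j < m \<Longrightarrow> lpnorm q \<Omega> (F j) \<le> N" "0 \<le> N"
  shows "\<exists>S. lpnorm q \<Omega> (\<lambda>w. \<Sum>j<m. sgn_at S j *\<^sub>R F j w) \<le> real m / 2 * N"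
proof -
  define h where "h S = (\<Sum>w\<in>\<Omega>. norm (\<Sum>j<m. sgn_at S j *\<^sub>R F j w) powr q)" for S
  have "(\<Sum>S\<in>Pow {..<m}. h S) / 2 ^ m
      = (\<Sum>w\<in>\<Omega>. (\<Sum>S\<in>Pow {..<m}. norm (\<Sum>j<m. sgn_at S j *\<^sub>R F j w) powr q) / 2 ^ m)"
    unfolding h_def by (subst sum.swap) (simp add: sum_divide_distrib)
  also have "\<dots> \<le> (\<Sum>w\<in>\<Omega>. M * (real m powr (q - p) * (\<Sum>j<m. norm (F j w) powr q)))"
    by (intro sum_mono type_estimate_higher_moment T p m)
  also have "\<dots> = M * (real m powr (q - p) * (\<Sum>j<m. \<Sum>w\<in>\<Omega>. norm (F j w) powr q))"
    by (subst sum.swap) (simp add: sum_distrib_left)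
  also have "\<dots> \<le> M * (real m powr (q - p) * (\<Sum>j<m. N powr q))"
    using T N p lpnorm_le_iff[of q N \<Omega>]
    by (intro mult_left_mono sum_mono) (auto simp: type_estimate_def)
  also have "\<dots> = (M * 2 powr q) * (real m powr (q - p) * real m) * (N powr q / 2 powr q)"
    by simp
  also have "\<dots> \<le> real m powr (p - 1) * (real m powr (q - p) * real m) * (N powr q / 2 powr q)"
    by (intro mult_right_mono large) auto
  also have "real m powr (p - 1) * (real m powr (q - p) * real m) = real m powr q"
  proof -
    have "real m powr (p - 1) * (real m powr (q - p) * real m powr 1) = real m powr q"
      unfolding powr_add[symmetric] by simp
    then show ?thesis using m by simp
  qed
  also have "real m powr q * (N powr q / 2 powr q) = (real m / 2 * N) powr q"
    using N by (simp add: powr_mult powr_divide)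
  finally have avg: "(\<Sum>S\<in>Pow {..<m}. h S) \<le> (\<Sum>S\<in>Pow {..<m}. (real m / 2 * N) powr q)"
    by (simp add: card_Pow field_simps)
  have "\<exists>S\<in>Pow {..<m}. h S \<le> (real m / 2 * N) powr q"
  proof (rule ccontr)
    assume "\<not> ?thesis"
    then have "(real m / 2 * N) powr q < h S" if "S \<in> Pow {..<m}" for S
      using that not_le by blast
    then have "(\<Sum>S\<in>Pow {..<m}. (real m / 2 * N) powr q) < (\<Sum>S\<in>Pow {..<m}. h S)"
      by (intro sum_strict_mono) auto
    then show False using avg by simp
  qed
  then obtain S where "h S \<le> (real m / 2 * N) powr q" by blast
  then have "lpnorm q \<Omega> (\<lambda>w. \<Sum>j<m. sgn_at S j *\<^sub>R F j w) \<le> real m / 2 * N"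
    using N p by (subst lpnorm_le_iff) (auto simp: h_def)
  then show ?thesis by blast
qed

lemma walsh_sum_sum: "walsh_sum n (\<lambda>A. \<Sum>j\<in>J. y j A) S = (\<Sum>j\<in>J. walsh_sum n (y j) S)"
  unfolding walsh_sum_def by (simp add: scaleR_sum_right) (rule sum.swap)

text \<open>
  Along the chain \<open>Q \<union> {..<j}\<close> the parity of the cardinality changes from \<open>j\<close> to \<open>Suc j\<close> exactly if
  \<open>j \<notin> Q\<close>. Hence a suitable \<open>Q\<close> realises every sign pattern up to a global sign.
\<close>
lemma chain_parity:
  fixes S :: "nat set" and m :: nat
  defines "Q \<equiv> {i. Suc i < m \<and> sgn_at S (Suc i) = sgn_at S i}"
  obtains \<sigma> :: real where "\<bar>\<sigma>\<bar> = 1" "\<And>j. j < m \<Longrightarrow> (-1) ^ card (Q \<union> {..<j}) = \<sigma> * sgn_at S j"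
proof
  define \<sigma> where "\<sigma> = (-1) ^ card Q * sgn_at S 0"
  show "\<bar>\<sigma>\<bar> = 1" by (simp add: \<sigma>_def abs_mult sgn_at_def power_abs)
  have fin: "finite Q" by (rule finite_subset[of _ "{..<m}"]) (auto simp: Q_def)
  fix j assume "j < m"
  then show "(-1) ^ card (Q \<union> {..<j}) = \<sigma> * sgn_at S j"
  proof (induction j)
    case 0
    then show ?case by (simp add: \<sigma>_def sgn_at_def)
  next
    case (Suc j)
    have IH: "(-1) ^ card (Q \<union> {..<j}) = \<sigma> * sgn_at S j" using Suc by simp
    have *: "Q \<union> {..<Suc j} = insert j (Q \<union> {..<j})" by (auto simp: less_Suc_eq)
    show ?case
    proof (cases "j \<in> Q")
      case True
      then have "Q \<union> {..<Suc j} = Q \<union> {..<j}" unfolding * by auto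
      then show ?thesis using IH True by (simp add: Q_def)
    next
      case False
      then have "card (Q \<union> {..<Suc j}) = Suc (card (Q \<union> {..<j}))" unfolding * using fin by simp
      moreover have "sgn_at S (Suc j) = - sgn_at S j"
        using False Suc.prems by (auto simp: Q_def sgn_at_def split: if_splits)
      ultimately show ?thesis using IH by simp
    qed
  qed
qed

text \<open>
  Expand the product into \<open>2\<^sup>m\<close> terms \<open>\<plusminus> E\<^sub>W\<close>, where \<open>E\<^sub>W\<close> is a product of conditional expectations.
  If its norm were close to \<open>2\<^sup>m\<close>, then no cancellation could occur between any of these terms. But for
  the \<open>m\<close> functions \<open>F\<^sub>j\<close> obtained by applying the first \<open>j\<close> expectations, some signed sum is smaller
  by a factor \<open>2\<close> than \<open>m\<close>, and applying \<open>E\<^sub>Q\<close> with \<open>Q\<close> from \<open>chain_parity\<close> turns this sum into a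
  sum of \<open>m\<close> terms of the expansion with their own signs, up to a global sign.
\<close>
lemma cond_exp_product_bound:
  assumes T: "type_estimate TYPE('b::real_normed_vector) p M" and p: "1 \<le> p" "p \<le> q" and m: "0 < m"
    and large: "M * 2 powr q \<le> real m powr (p - 1)"
  shows "walsh_bound TYPE('b) q n (\<lambda>A. \<Prod>i<m. 1 - of_bool (A \<subseteq> R i)) ((1 - 1 / 2 ^ Suc m) * 2 ^ m)"
  unfolding walsh_bound_def
proof
  fix y :: "nat set \<Rightarrow> 'b"
  have q: "1 \<le> q" using p by simp
  let ?\<Omega> = "Pow {..<n}"
  define N where "N = lpnorm q ?\<Omega> (walsh_sum n y)"
  define e :: "nat set \<Rightarrow> nat set \<Rightarrow> real" where "e W A = of_bool (\<forall>i\<in>W. A \<subseteq> R i)" for W A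
  define g :: "nat set \<Rightarrow> real" where "g A = (\<Prod>i<m. 1 - of_bool (A \<subseteq> R i))" for A
  have be: "walsh_bound TYPE('b) q n (e W) 1" for W
  proof -
    have "e W = (\<lambda>A. of_bool (A \<subseteq> (\<Inter>i\<in>W. R i)))" by (auto simp: e_def fun_eq_iff)
    then show ?thesis using walsh_bound_cond_exp[OF q] by simp
  qed
  define F where "F j = walsh_sum n (\<lambda>A. e {..<j} A *\<^sub>R y A)" for j
  have "lpnorm q ?\<Omega> (F j) \<le> N" for j
    using be[of "{..<j}"] by (simp add: F_def N_def walsh_bound_def)
  then obtain S where S: "lpnorm q ?\<Omega> (\<lambda>w. \<Sum>j<m. sgn_at S j *\<^sub>R F j w) \<le> real m / 2 * N"
    using exists_small_signed_sum[OF T p m large, of ?\<Omega> F N] by (auto simp: N_def)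
  define Q where "Q = {i. Suc i < m \<and> sgn_at S (Suc i) = sgn_at S i}"
  obtain \<sigma> :: real where \<sigma>: "\<bar>\<sigma>\<bar> = 1" "\<And>j. j < m \<Longrightarrow> (-1) ^ card (Q \<union> {..<j}) = \<sigma> * sgn_at S j"
    using chain_parity[of m S] unfolding Q_def by blast
  have Qm: "Q \<union> {..<j} \<subseteq> {..<m}" if "j < m" for j using that by (auto simp: Q_def)
  define rest where "rest A = (\<Sum>j<m. \<Sum>W\<in>Pow {..<m} - {Q \<union> {..<j}}. (-1) ^ card W * e W A)" for A
  have g: "g A = (\<Sum>W\<in>Pow {..<m}. (-1) ^ card W * e W A)" for A
  proof -
    have "g A = (\<Prod>i<m. - of_bool (A \<subseteq> R i) + 1)" by (simp add: g_def)
    also have "\<dots> = (\<Sum>W\<in>Pow {..<m}. (\<Prod>i\<in>W. - of_bool (A \<subseteq> R i)) * (\<Prod>i\<in>{..<m} - W. 1))"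
      by (rule prod_add) simp
    also have "\<dots> = (\<Sum>W\<in>Pow {..<m}. (-1) ^ card W * e W A)"
    proof (intro sum.cong refl)
      fix W assume "W \<in> Pow {..<m}"
      then have "finite W" using finite_subset by blast
      then have "(\<Prod>i\<in>W. of_bool (A \<subseteq> R i)) = e W A" by (auto simp: e_def of_bool_def)
      then show "(\<Prod>i\<in>W. - of_bool (A \<subseteq> R i)) * (\<Prod>i\<in>{..<m} - W. 1) = (-1) ^ card W * e W A"
        by (simp add: prod_uminus)
    qed
    finally show ?thesis .
  qed
  \<comment> \<open>Take \<open>m\<close> copies of the expansion and remove from the \<open>j\<close>-th copy the term \<open>Q \<union> {..<j}\<close>. The
      removed terms form the small signed sum; every copy keeps \<open>2 ^ m - 1\<close> terms. Using copies allows
      the sets \<open>Q \<union> {..<j}\<close> to coincide.\<close>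
  have mg: "real m * g A = \<sigma> * (\<Sum>j<m. sgn_at S j * (e Q A * e {..<j} A)) + rest A" for A
  proof -
    have "real m * g A = (\<Sum>j<m. \<Sum>W\<in>Pow {..<m}. (-1) ^ card W * e W A)" by (simp add: g)
    also have "\<dots> = (\<Sum>j<m. (-1) ^ card (Q \<union> {..<j}) * e (Q \<union> {..<j}) A
        + (\<Sum>W\<in>Pow {..<m} - {Q \<union> {..<j}}. (-1) ^ card W * e W A))"
      using Qm by (intro sum.cong sum.remove) auto
    also have "\<dots> = (\<Sum>j<m. \<sigma> * (sgn_at S j * (e Q A * e {..<j} A))
        + (\<Sum>W\<in>Pow {..<m} - {Q \<union> {..<j}}. (-1) ^ card W * e W A))"
    proof (intro sum.cong refl)
      fix j assume "j \<in> {..<m}"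
      moreover have "e (Q \<union> {..<j}) A = e Q A * e {..<j} A" by (auto simp: e_def)
      ultimately show "(-1) ^ card (Q \<union> {..<j}) * e (Q \<union> {..<j}) A
        + (\<Sum>W\<in>Pow {..<m} - {Q \<union> {..<j}}. (-1) ^ card W * e W A) = \<sigma> * (sgn_at S j * (e Q A * e {..<j} A))
        + (\<Sum>W\<in>Pow {..<m} - {Q \<union> {..<j}}. (-1) ^ card W * e W A)"
        using \<sigma>(2)[of j] by simp
    qed
    finally show ?thesis by (simp add: sum.distrib sum_distrib_left rest_def)
  qed
  have brest: "walsh_bound TYPE('b) q n rest (real m * (2 ^ m - 1))"
  proof -
    have "walsh_bound TYPE('b) q n rest (\<Sum>j<m. \<Sum>W\<in>Pow {..<m} - {Q \<union> {..<j}}. \<bar>(-1) ^ card W\<bar> * 1)"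
      unfolding rest_def by (intro walsh_bound_sum walsh_bound_scale be q) auto
    moreover have "(\<Sum>j<m. \<Sum>W\<in>Pow {..<m} - {Q \<union> {..<j}}. \<bar>(-1) ^ card W\<bar> * 1) = real m * (2 ^ m - 1)"
      using Qm by (simp add: power_abs card_Diff_singleton card_Pow of_nat_diff)
    ultimately show ?thesis by simp
  qed
  define Z where "Z A = (\<Sum>j<m. (sgn_at S j * e {..<j} A) *\<^sub>R y A)" for A
  have Z: "walsh_sum n Z w = (\<Sum>j<m. sgn_at S j *\<^sub>R F j w)" for w
    unfolding Z_def F_def walsh_sum_sum
    by (simp add: walsh_sum_scale[symmetric])
  have split: "walsh_sum n (\<lambda>A. (real m * g A) *\<^sub>R y A) =
      (\<lambda>w. \<sigma> *\<^sub>R walsh_sum n (\<lambda>A. e Q A *\<^sub>R Z A) w + walsh_sum n (\<lambda>A. rest A *\<^sub>R y A) w)"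
    unfolding mg walsh_sum_scale[symmetric] walsh_sum_add[symmetric]
    by (simp add: Z_def scaleR_add_left scaleR_sum_left scaleR_sum_right sum_distrib_left mult_ac)
  have "lpnorm q ?\<Omega> (walsh_sum n (\<lambda>A. (real m * g A) *\<^sub>R y A)) \<le>
      lpnorm q ?\<Omega> (\<lambda>w. \<sigma> *\<^sub>R walsh_sum n (\<lambda>A. e Q A *\<^sub>R Z A) w) + lpnorm q ?\<Omega> (walsh_sum n (\<lambda>A. rest A *\<^sub>R y A))"
    unfolding split by (rule lpnorm_triangle[OF q]) simp
  also have "lpnorm q ?\<Omega> (\<lambda>w. \<sigma> *\<^sub>R walsh_sum n (\<lambda>A. e Q A *\<^sub>R Z A) w) = lpnorm q ?\<Omega> (walsh_sum n (\<lambda>A. e Q A *\<^sub>R Z A))"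
    using q \<sigma>(1) by (subst lpnorm_scale) auto
  also have "\<dots> \<le> lpnorm q ?\<Omega> (walsh_sum n Z)"
    using be[of Q] by (simp add: walsh_bound_def)
  also have "\<dots> \<le> real m / 2 * N" using S by (simp add: Z[abs_def])
  also have "lpnorm q ?\<Omega> (walsh_sum n (\<lambda>A. rest A *\<^sub>R y A)) \<le> real m * (2 ^ m - 1) * N"
    using brest by (simp add: walsh_bound_def N_def)
  finally have "lpnorm q ?\<Omega> (walsh_sum n (\<lambda>A. (real m * g A) *\<^sub>R y A)) \<le> real m * ((2 ^ m - 1 / 2) * N)"
    by (simp add: algebra_simps)
  moreover have "lpnorm q ?\<Omega> (walsh_sum n (\<lambda>A. (real m * g A) *\<^sub>R y A))
      = real m * lpnorm q ?\<Omega> (walsh_sum n (\<lambda>A. g A *\<^sub>R y A))"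
    using lpnorm_scale[of q ?\<Omega> "real m" "walsh_sum n (\<lambda>A. g A *\<^sub>R y A)"] q
    by (simp add: walsh_sum_scale[symmetric])
  ultimately have "lpnorm q ?\<Omega> (walsh_sum n (\<lambda>A. g A *\<^sub>R y A)) \<le> (2 ^ m - 1 / 2) * N"
    using m by simp
  moreover have "(2 ^ m - 1 / 2 :: real) = (1 - 1 / 2 ^ Suc m) * 2 ^ m" by (simp add: field_simps)
  ultimately show "lpnorm q ?\<Omega> (walsh_sum n (\<lambda>A. (\<Prod>i<m. 1 - of_bool (A \<subseteq> R i)) *\<^sub>R y A)) \<le>
      (1 - 1 / 2 ^ Suc m) * 2 ^ m * lpnorm q ?\<Omega> (walsh_sum n y)"
    by (simp add: g_def N_def)
qed

text \<open>
  Pisier's theorem: a space of type \<open>p > 1\<close> is K-convex.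
\<close>
theorem rademacher_projection_bounded:
  assumes T: "type_estimate TYPE('b::real_normed_vector) p M" and p: "1 < p" "p \<le> q"
  shows "\<exists>K>0. \<forall>n. walsh_bound TYPE('b) q n (\<lambda>A. if card A = 1 then 1 else 0) K"
proof -
  have "filterlim (\<lambda>m. real m powr (p - 1)) at_top sequentially"
    using p by real_asymp
  then have "eventually (\<lambda>m. M * 2 powr q \<le> real m powr (p - 1)) sequentially"
    unfolding filterlim_at_top by blast
  then have "eventually (\<lambda>m. M * 2 powr q \<le> real m powr (p - 1) \<and> 0 < m) sequentially"
    using eventually_gt_at_top[of "0::nat"] by eventually_elim auto
  then obtain m where m: "M * 2 powr q \<le> real m powr (p - 1)" "0 < m"
    using eventually_happens[of _ sequentially] by auto
  define \<theta> :: real where "\<theta> = 1 - 1 / 2 ^ Suc m"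
  have \<theta>: "0 \<le> \<theta>" "\<theta> < 1" using one_le_power[of "2::real" "Suc m"] by (auto simp: \<theta>_def)
  obtain K where K: "0 < K" "\<And>n B. level_multipliers n B \<Longrightarrow>
      (\<forall>x. 0 \<le> x \<and> x \<le> 1 \<longrightarrow> B (\<lambda>k. (1 - x ^ k) ^ m) (\<theta> * 2 ^ m)) \<Longrightarrow>
      B (\<lambda>k. if k = 1 then 1 else 0) K"
    using level_one_bound[OF m(2) \<theta>] by blast
  have "walsh_bound TYPE('b) q n (\<lambda>A. if card A = 1 then 1 else 0) K" for n
  proof -
    have q: "1 \<le> q" using p by simp
    have "walsh_bound TYPE('b) q n (\<lambda>A. (1 - x ^ card A) ^ m) (\<theta> * 2 ^ m)" if "0 \<le> x" "x \<le> 1" for x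
      unfolding \<theta>_def using p by (intro noise_difference_bound q that cond_exp_product_bound[OF T _ _ m(2,1)]) auto
    then show ?thesis
      using K(2)[OF level_multipliers_walsh[OF q, of n, where 'b = 'b]] \<theta> by auto
  qed
  then show ?thesis using K(1) by blast
qed

section \<open>Walsh coefficients and signed sums\<close>

definition sign_average :: "nat \<Rightarrow> (nat set \<Rightarrow> real) \<Rightarrow> real" where
  "sign_average n h = (\<Sum>S\<in>Pow {..<n}. h S) / 2 ^ n"

definition signed_sum :: "nat \<Rightarrow> (nat \<Rightarrow> 'a::real_vector) \<Rightarrow> nat set \<Rightarrow> 'a" where
  "signed_sum n x S = (\<Sum>j<n. sgn_at S j *\<^sub>R x j)"

lemma sign_average_mono:
  "(\<And>S. S \<subseteq> {..<n} \<Longrightarrow> h S \<le> h' S) \<Longrightarrow> sign_average n h \<le> sign_average n h'"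
  unfolding sign_average_def by (intro divide_right_mono sum_mono) auto

lemma sign_average_const [simp]: "sign_average n (\<lambda>S. c) = c"
  by (simp add: sign_average_def card_Pow)

lemma sign_average_add: "sign_average n (\<lambda>S. h S + h' S) = sign_average n h + sign_average n h'"
  by (simp add: sign_average_def sum.distrib add_divide_distrib)

lemma sign_average_scale: "sign_average n (\<lambda>S. c * h S) = c * sign_average n h"
  by (simp add: sign_average_def sum_distrib_left)

lemma sign_average_sym_diff:
  "V \<subseteq> {..<n} \<Longrightarrow> sign_average n (\<lambda>S. h (sym_diff S V)) = sign_average n h"
  unfolding sign_average_def by (subst sum_sym_diff) auto

lemma sign_average_jensen:
  assumes "1 \<le> r" "\<And>S. 0 \<le> h S"
  shows "sign_average n h powr r \<le> sign_average n (\<lambda>S. h S powr r)"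
proof -
  have "(\<Sum>S\<in>Pow {..<n}. h S) powr r \<le> real (card (Pow {..<n})) powr (r - 1) * (\<Sum>S\<in>Pow {..<n}. h S powr r)"
    using assms by (intro sum_powr_le) auto
  also have "real (card (Pow {..<n})) powr (r - 1) = (2 ^ n) powr r / 2 ^ n"
    by (simp add: card_Pow powr_diff)
  finally show ?thesis
    by (simp add: sign_average_def powr_divide sum_nonneg assms field_simps)
qed

lemma sum_walsh:
  assumes "finite I" "W \<subseteq> I" "W \<noteq> {}"
  shows "(\<Sum>A\<in>Pow I. walsh A W) = 0"
proof -
  have "(\<Sum>A\<in>Pow I. walsh A W) = (\<Prod>i\<in>I. sgn_at W i + 1)"
    using assms by (subst prod_add) (auto simp: walsh_def)
  also have "\<dots> = 0"
    using assms by (intro prod_zero) (auto simp: sgn_at_def)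
  finally show ?thesis .
qed

definition walsh_coeff :: "nat \<Rightarrow> (nat set \<Rightarrow> 'b::real_normed_vector) \<Rightarrow> nat set \<Rightarrow> 'b" where
  "walsh_coeff n F A = (\<Sum>S\<in>Pow {..<n}. walsh A S *\<^sub>R F S) /\<^sub>R 2 ^ n"

lemma walsh_inversion:
  assumes S: "S \<subseteq> {..<n}"
  shows "walsh_sum n (walsh_coeff n F) S = F S"
proof -
  have "walsh_sum n (walsh_coeff n F) S =
      (\<Sum>A\<in>Pow {..<n}. \<Sum>V\<in>Pow {..<n}. walsh A (sym_diff S V) *\<^sub>R F V) /\<^sub>R 2 ^ n"
    unfolding walsh_sum_def walsh_coeff_def walsh_sym_diff
    by (simp add: scaleR_sum_right mult_ac)
  also have "\<dots> = (\<Sum>V\<in>Pow {..<n}. (\<Sum>A\<in>Pow {..<n}. walsh A (sym_diff S V)) *\<^sub>R F V) /\<^sub>R 2 ^ n"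
    by (subst sum.swap) (simp add: scaleR_sum_left)
  also have "(\<Sum>V\<in>Pow {..<n}. (\<Sum>A\<in>Pow {..<n}. walsh A (sym_diff S V)) *\<^sub>R F V)
      = (\<Sum>V\<in>Pow {..<n}. if V = S then 2 ^ n *\<^sub>R F S else 0)"
  proof (intro sum.cong refl)
    fix V assume V: "V \<in> Pow {..<n}"
    show "(\<Sum>A\<in>Pow {..<n}. walsh A (sym_diff S V)) *\<^sub>R F V = (if V = S then 2 ^ n *\<^sub>R F S else 0)"
    proof (cases "V = S")
      case True
      then show ?thesis by (simp add: walsh_def sgn_at_def card_Pow)
    next
      case False
      then have "sym_diff S V \<noteq> {}" "sym_diff S V \<subseteq> {..<n}" using S V by auto
      then show ?thesis using False sum_walsh[of "{..<n}" "sym_diff S V"] by simp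
    qed
  qed
  also have "\<dots> = 2 ^ n *\<^sub>R F S" using S by simp
  finally show ?thesis by simp
qed

lemma walsh_sum_level_one:
  assumes "\<And>A. card A \<noteq> 1 \<Longrightarrow> y A = 0"
  shows "walsh_sum n y S = signed_sum n (\<lambda>j. y {j}) S"
proof -
  have "walsh_sum n y S = (\<Sum>A\<in>(\<lambda>j. {j}) ` {..<n}. walsh A S *\<^sub>R y A)"
    unfolding walsh_sum_def
  proof (rule sum.mono_neutral_right)
    show "\<forall>A\<in>Pow {..<n} - (\<lambda>j. {j}) ` {..<n}. walsh A S *\<^sub>R y A = 0"
    proof
      fix A assume A: "A \<in> Pow {..<n} - (\<lambda>j. {j}) ` {..<n}"
      have "card A \<noteq> 1"
      proof
        assume "card A = 1"
        then obtain j where "A = {j}" using card_1_singletonE by blast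
        then show False using A by auto
      qed
      then show "walsh A S *\<^sub>R y A = 0" using assms by simp
    qed
  qed auto
  also have "\<dots> = signed_sum n (\<lambda>j. y {j}) S"
    unfolding signed_sum_def by (subst sum.reindex) (auto simp: walsh_def)
  finally show ?thesis .
qed

text \<open>
  The multiplier \<open>walsh_bound_prod\<close> applied to a function with terms of level one only.
\<close>
lemma contraction_principle:
  fixes x :: "nat \<Rightarrow> 'a::real_normed_vector"
  assumes q: "1 \<le> q" and a: "\<And>j. j < n \<Longrightarrow> \<bar>a j\<bar> \<le> 1"
  shows "sign_average n (\<lambda>S. norm (signed_sum n (\<lambda>j. a j *\<^sub>R x j) S) powr q)
      \<le> sign_average n (\<lambda>S. norm (signed_sum n x S) powr q)"
proof -
  define y where "y A = (if card A = 1 then x (the_elem A) else 0)" for A :: "nat set"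
  have 1: "walsh_sum n y S = signed_sum n x S" for S
    by (subst walsh_sum_level_one) (auto simp: y_def)
  have 2: "walsh_sum n (\<lambda>A. (\<Prod>i\<in>A. a i) *\<^sub>R y A) S = signed_sum n (\<lambda>j. a j *\<^sub>R x j) S" for S
    by (subst walsh_sum_level_one) (auto simp: y_def)
  have "lpnorm q (Pow {..<n}) (walsh_sum n (\<lambda>A. (\<Prod>i\<in>A. a i) *\<^sub>R y A)) \<le> lpnorm q (Pow {..<n}) (walsh_sum n y)"
    using walsh_bound_prod[OF q a, where 'b = 'a] by (simp add: walsh_bound_def)
  then have "(\<Sum>S\<in>Pow {..<n}. norm (signed_sum n (\<lambda>j. a j *\<^sub>R x j) S) powr q)
      \<le> (\<Sum>S\<in>Pow {..<n}. norm (signed_sum n x S) powr q)"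
    using q by (subst (asm) lpnorm_le_iff) (auto simp: lpnorm_powr 1 2)
  then show ?thesis unfolding sign_average_def by (intro divide_right_mono) auto
qed

lemma type_estimate_of_has_type:
  assumes "has_type TYPE('b::banach) p"
  shows "1 < p \<and> p \<le> 2 \<and> (\<exists>M. type_estimate TYPE('b) p M)"
proof -
  obtain T where "1 < p" "p \<le> 2" "0 < T" and
    T: "\<And>n (x :: nat \<Rightarrow> 'b). sign_expectation n (\<lambda>e. norm (\<Sum>j<n. e j *\<^sub>R x j) powr p)
          \<le> T powr p * (\<Sum>j<n. norm (x j) powr p)"
    using assms unfolding has_type_def by auto
  moreover have "type_estimate TYPE('b) p (T powr p)"
    unfolding type_estimate_def using T[unfolded sign_expectation_norm_sum] \<open>0 < T\<close> by simp
  ultimately show ?thesis by blast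
qed

lemma has_cotype_iff:
  "has_cotype TYPE('b::banach) q \<longleftrightarrow> 2 \<le> q \<and> (\<exists>C>0. \<forall>n (x :: nat \<Rightarrow> 'b).
      (\<Sum>j<n. norm (x j) powr q) \<le> C powr q * sign_average n (\<lambda>S. norm (signed_sum n x S) powr q))"
proof -
  have "C powr (- q) * s \<le> t \<longleftrightarrow> s \<le> C powr q * t" if "0 < C" for C s t :: real
    using that by (simp add: powr_minus field_simps)
  then show ?thesis
    unfolding has_cotype_def sign_expectation_norm_sum sign_average_def signed_sum_def by auto
qed

text \<open>
  Cotype controls the coefficients of the Rademacher sum \<open>\<Sum>\<epsilon>\<^sub>j F\<^sub>j\<close> formed by the level-one
  coefficients \<open>F\<^sub>j\<close>, and this sum is the Rademacher projection of \<open>F\<close>. This is the only way in which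
  the geometry of the target space enters the nonlinear argument.
\<close>
theorem level_one_coefficients:
  assumes type: "has_nontrivial_type TYPE('b::banach)" and cotype: "has_cotype TYPE('b) q"
  shows "\<exists>C>0. \<forall>n (F :: nat set \<Rightarrow> 'b).
    (\<Sum>j<n. norm (walsh_coeff n F {j}) powr q) \<le> C powr q * sign_average n (\<lambda>S. norm (F S) powr q)"
proof -
  obtain p M where p: "1 < p" "p \<le> 2" and M: "type_estimate TYPE('b) p M"
    using type type_estimate_of_has_type unfolding has_nontrivial_type_def by blast
  obtain C where C: "0 < C" and q: "2 \<le> q" and ct: "\<And>n (x :: nat \<Rightarrow> 'b).
      (\<Sum>j<n. norm (x j) powr q) \<le> C powr q * sign_average n (\<lambda>S. norm (signed_sum n x S) powr q)"
    using cotype by (auto simp: has_cotype_iff)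
  obtain K where K: "0 < K" "\<And>n. walsh_bound TYPE('b) q n (\<lambda>A. if card A = 1 then 1 else 0) K"
    using rademacher_projection_bounded[OF M p(1), of q] p q by auto
  show ?thesis
  proof (intro exI[of _ "C * K"] conjI allI)
    fix n and F :: "nat set \<Rightarrow> 'b"
    let ?c = "walsh_coeff n F"
    have 1: "walsh_sum n (\<lambda>A. (if card A = 1 then 1 else 0) *\<^sub>R ?c A) S = signed_sum n (\<lambda>j. ?c {j}) S" for S
      by (subst walsh_sum_level_one) auto
    have "lpnorm q (Pow {..<n}) (walsh_sum n (\<lambda>A. (if card A = 1 then 1 else 0) *\<^sub>R ?c A))
        \<le> K * lpnorm q (Pow {..<n}) (walsh_sum n ?c)"
      using K(2)[of n] unfolding walsh_bound_def by blast
    then have "(\<Sum>S\<in>Pow {..<n}. norm (signed_sum n (\<lambda>j. ?c {j}) S) powr q)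
        \<le> K powr q * (\<Sum>S\<in>Pow {..<n}. norm (walsh_sum n ?c S) powr q)"
      using q K(1) unfolding 1[abs_def] by (subst (asm) lpnorm_le_iff) (auto simp: lpnorm_powr powr_mult)
    also have "(\<Sum>S\<in>Pow {..<n}. norm (walsh_sum n ?c S) powr q) = (\<Sum>S\<in>Pow {..<n}. norm (F S) powr q)"
      by (intro sum.cong) (auto simp: walsh_inversion)
    finally have "sign_average n (\<lambda>S. norm (signed_sum n (\<lambda>j. ?c {j}) S) powr q)
        \<le> K powr q * sign_average n (\<lambda>S. norm (F S) powr q)"
      by (simp add: sign_average_def field_simps)
    then have "C powr q * sign_average n (\<lambda>S. norm (signed_sum n (\<lambda>j. ?c {j}) S) powr q)
        \<le> C powr q * (K powr q * sign_average n (\<lambda>S. norm (F S) powr q))"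
      by (intro mult_left_mono) auto
    also have "C powr q * (K powr q * sign_average n (\<lambda>S. norm (F S) powr q))
        = (C * K) powr q * sign_average n (\<lambda>S. norm (F S) powr q)"
      using C K(1) by (simp add: powr_mult)
    finally show "(\<Sum>j<n. norm (?c {j}) powr q) \<le> (C * K) powr q * sign_average n (\<lambda>S. norm (F S) powr q)"
      using ct[of "\<lambda>j. ?c {j}" n] by (rule order_trans[rotated])
  qed (use C K(1) in simp)
qed

section \<open>The metric cotype estimate\<close>

lemma signed_sum_sym_diff:
  assumes "j < n"
  shows "signed_sum n x (sym_diff S {j}) = signed_sum n x S - (2 * sgn_at S j) *\<^sub>R x j"
proof -
  have "signed_sum n x (sym_diff S {j}) = (\<Sum>i<n. sgn_at S i *\<^sub>R x i - (if i = j then (2 * sgn_at S j) *\<^sub>R x j else 0))"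
    unfolding signed_sum_def by (intro sum.cong) (auto simp: sgn_at_def scaleR_2)
  also have "\<dots> = signed_sum n x S - (2 * sgn_at S j) *\<^sub>R x j"
    using assms by (simp add: sum_subtractf signed_sum_def)
  finally show ?thesis .
qed

lemma average_norm_le_moment:
  assumes q: "1 \<le> q" and s: "0 \<le> s" "sign_average n (\<lambda>S. norm (signed_sum n x S) powr q) \<le> s powr q"
  shows "sign_average n (\<lambda>S. norm (signed_sum n x S)) \<le> s"
proof -
  have 0: "0 \<le> sign_average n (\<lambda>S. norm (signed_sum n x S))"
    by (auto simp: sign_average_def intro!: sum_nonneg divide_nonneg_pos)
  have "sign_average n (\<lambda>S. norm (signed_sum n x S)) powr q \<le> s powr q"
    using sign_average_jensen[OF q, of "\<lambda>S. norm (signed_sum n x S)" n] s by simp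
  then show ?thesis
    using powr_less_mono2[of q s] q s 0 by (meson not_le not_less order_less_le_trans zero_less_one)
qed

text \<open>
  Flipping the sign of one summand moves the signed sum by \<open>2 \<parallel>x\<^sub>j\<parallel>\<close> and preserves its distribution.
\<close>
lemma norm_le_average:
  assumes "j < n"
  shows "norm (x j) \<le> sign_average n (\<lambda>S. norm (signed_sum n x S))"
proof -
  have "2 * norm (x j) = sign_average n (\<lambda>S. 2 * norm (x j))" by simp
  also have "\<dots> \<le> sign_average n (\<lambda>S. norm (signed_sum n x S) + norm (signed_sum n x (sym_diff S {j})))"
  proof (rule sign_average_mono)
    fix S
    have "2 * norm (x j) = norm (signed_sum n x S - signed_sum n x (sym_diff S {j}))"
      using assms by (simp add: signed_sum_sym_diff sgn_at_def)
    also have "\<dots> \<le> norm (signed_sum n x S) + norm (signed_sum n x (sym_diff S {j}))"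
      by (rule norm_triangle_ineq4)
    finally show "2 * norm (x j) \<le> norm (signed_sum n x S) + norm (signed_sum n x (sym_diff S {j}))" .
  qed
  also have "\<dots> = 2 * sign_average n (\<lambda>S. norm (signed_sum n x S))"
    using assms sign_average_sym_diff[of "{j}" n "\<lambda>S. norm (signed_sum n x S)"] by (simp add: sign_average_add)
  finally show ?thesis by simp
qed

lemma sum_PiE_coordinate:
  fixes \<phi> :: "('i \<Rightarrow> 'c) \<Rightarrow> 'd::comm_monoid_add"
  assumes "j \<in> I"
  shows "(\<Sum>l\<in>I \<rightarrow>\<^sub>E A. \<phi> l) = (\<Sum>l\<in>(I - {j}) \<rightarrow>\<^sub>E A. \<Sum>t\<in>A. \<phi> (l(j := t)))"
proof -
  let ?J = "I - {j}"
  have I: "I = insert j ?J" using assms by blast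
  have "(\<Sum>l\<in>I \<rightarrow>\<^sub>E A. \<phi> l) = (\<Sum>z\<in>A \<times> (?J \<rightarrow>\<^sub>E A). \<phi> ((\<lambda>(t, l). l(j := t)) z))"
  proof (rule sum.reindex_cong)
    show "inj_on (\<lambda>(t, l). l(j := t)) (A \<times> (?J \<rightarrow>\<^sub>E A))"
      by (rule inj_combinator) simp
    show "I \<rightarrow>\<^sub>E A = (\<lambda>(t, l). l(j := t)) ` (A \<times> (?J \<rightarrow>\<^sub>E A))"
      by (subst I, subst PiE_insert_eq) simp
  qed simp
  also have "\<dots> = (\<Sum>t\<in>A. \<Sum>l\<in>?J \<rightarrow>\<^sub>E A. \<phi> (l(j := t)))"
    by (simp add: sum.cartesian_product split_def)
  also have "\<dots> = (\<Sum>l\<in>?J \<rightarrow>\<^sub>E A. \<Sum>t\<in>A. \<phi> (l(j := t)))" by (rule sum.swap)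
  finally show ?thesis .
qed

text \<open>
  Each base point \<open>u\<close> gives a bound for \<open>\<Sum>\<parallel>D j u\<parallel>\<^sup>q\<close> that is independent of \<open>u\<close>, since the
  increments of \<open>f\<close> are controlled by the distance alone. The base points run through the box of
  all \<open>\<Sum>(2 l\<^sub>i + 1) x\<^sub>i\<close> with \<open>l\<^sub>i < k\<close>. On a line of the box in direction \<open>j\<close> the vectors
  \<open>2 D j u\<close> are consecutive increments of \<open>h j\<close> and add up to a displacement by \<open>2 k x\<^sub>j\<close>, a vector of
  norm \<open>t\<close>. As \<open>h j\<close> is within \<open>2 a\<close> of \<open>f\<close>, their sum has norm at least \<open>8 a - 4 a\<close>. Because the box
  is a product, the lines in each direction partition it and no boundary terms arise.
\<close>
lemma lattice_estimate:
  fixes f :: "'a::real_normed_vector \<Rightarrow> 'b::real_normed_vector" and x :: "nat \<Rightarrow> 'a"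
  assumes coeff: "\<And>n (F :: nat set \<Rightarrow> 'b). (\<Sum>j<n. norm (walsh_coeff n F {j}) powr q)
        \<le> C powr q * sign_average n (\<lambda>S. norm (F S) powr q)"
    and C: "0 < C" and q: "1 \<le> q" and a: "0 < a" and L: "0 \<le> L" and r: "8 * a \<le> r"
    and upper: "\<And>u v. norm (f u - f v) \<le> a + L * norm (u - v)"
    and lower: "\<And>u v. norm (u - v) = t \<Longrightarrow> r \<le> norm (f u - f v)"
    and s: "0 \<le> s" "L * s \<le> a" "sign_average n (\<lambda>S. norm (signed_sum n x S) powr q) \<le> s powr q"
    and k: "0 < k"
  shows "real (card {j. j < n \<and> 2 * real k * norm (x j) = t}) \<le> (real k * C) powr q"
proof -
  \<comment> \<open>\<open>\<tau> j S\<close> is the signed sum without its \<open>j\<close>-th term, and \<open>h j\<close> averages \<open>f\<close> over these partial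
      sums.\<close>
  define F where "F u S = f (u + signed_sum n x S) - f u" for u S
  define D where "D j u = walsh_coeff n (F u) {j}" for j u
  define \<tau> where "\<tau> j S = signed_sum n x S - sgn_at S j *\<^sub>R x j" for j S
  define h where "h j v = (\<Sum>S\<in>Pow {..<n}. f (v + \<tau> j S)) /\<^sub>R 2 ^ n" for j v
  have F_bound: "sign_average n (\<lambda>S. norm (F u S) powr q) \<le> (2 * a) powr q" for u
  proof -
    have "norm (F u S) powr q \<le> 2 powr q * (1 / 2 * a powr q + 1 / 2 * (L * norm (signed_sum n x S)) powr q)" for S
    proof -
      let ?b = "L * norm (signed_sum n x S)"
      have b: "0 \<le> ?b" using L by simp
      have "norm (F u S) \<le> a + ?b"
        using upper[of "u + signed_sum n x S" u] by (simp add: F_def)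
      then have "norm (F u S) powr q \<le> (a + ?b) powr q"
        using q by (intro powr_mono2) auto
      also have "a + ?b = 2 * (1 / 2 * a + (1 - 1 / 2) * ?b)" by simp
      also have "\<dots> powr q = 2 powr q * (1 / 2 * a + (1 - 1 / 2) * ?b) powr q"
        by (rule powr_mult)
      also have "\<dots> \<le> 2 powr q * (1 / 2 * a powr q + (1 - 1 / 2) * ?b powr q)"
        using a b q by (intro mult_left_mono powr_mean_convex) auto
      finally show ?thesis by simp
    qed
    then have "sign_average n (\<lambda>S. norm (F u S) powr q) \<le>
        sign_average n (\<lambda>S. 2 powr q * (1 / 2 * a powr q + 1 / 2 * (L * norm (signed_sum n x S)) powr q))"
      by (intro sign_average_mono)
    also have "\<dots> = 2 powr q * (1 / 2 * a powr q +
        1 / 2 * (L powr q * sign_average n (\<lambda>S. norm (signed_sum n x S) powr q)))"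
      using L by (simp only: sign_average_scale sign_average_add sign_average_const powr_mult norm_ge_zero)
    also have "\<dots> \<le> 2 powr q * (1 / 2 * a powr q + 1 / 2 * (L powr q * s powr q))"
      using s by (intro mult_left_mono add_left_mono) auto
    also have "L powr q * s powr q \<le> a powr q"
      using s L q powr_mono2[of q "L * s" a] by (simp add: powr_mult)
    finally show ?thesis using a by (simp add: powr_mult)
  qed
  have level_one: "(\<Sum>j<n. norm (D j u) powr q) \<le> (2 * C * a) powr q" for u
  proof -
    have "(\<Sum>j<n. norm (D j u) powr q) \<le> C powr q * sign_average n (\<lambda>S. norm (F u S) powr q)"
      unfolding D_def by (rule coeff)
    also have "\<dots> \<le> C powr q * (2 * a) powr q"
      using F_bound by (intro mult_left_mono) auto
    finally show ?thesis using C a by (simp add: powr_mult mult_ac)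
  qed
  have avg: "sign_average n (\<lambda>S. norm (signed_sum n x S)) \<le> s"
    by (rule average_norm_le_moment[OF q s(1,3)])
  have \<tau>: "2 *\<^sub>R \<tau> j S = signed_sum n x S + signed_sum n x (sym_diff S {j})" if "j < n" for j S
    using that by (simp add: \<tau>_def signed_sum_sym_diff scaleR_diff_right scaleR_2 flip: scaleR_scaleR)
  have h_close: "norm (h j v - f v) \<le> 2 * a" if j: "j < n" for j v
  proof -
    have "h j v - f v = (\<Sum>S\<in>Pow {..<n}. f (v + \<tau> j S) - f v) /\<^sub>R 2 ^ n"
      by (simp add: h_def sum_subtractf scaleR_diff_right card_Pow sum_constant_scaleR)
    also have "norm \<dots> \<le> sign_average n (\<lambda>S. norm (f (v + \<tau> j S) - f v))"
      unfolding sign_average_def by (simp add: divide_inverse mult.commute norm_sum)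
    also have "\<dots> \<le> sign_average n (\<lambda>S. a + L * (1 / 2 * (norm (signed_sum n x S) + norm (signed_sum n x (sym_diff S {j})))))"
    proof (rule sign_average_mono)
      fix S
      have "2 * norm (\<tau> j S) = norm (2 *\<^sub>R \<tau> j S)" by simp
      also have "\<dots> \<le> norm (signed_sum n x S) + norm (signed_sum n x (sym_diff S {j}))"
        unfolding \<tau>[OF j] by (rule norm_triangle_ineq)
      finally have "L * norm (\<tau> j S) \<le> L * (1 / 2 * (norm (signed_sum n x S) + norm (signed_sum n x (sym_diff S {j}))))"
        using L by (intro mult_left_mono) auto
      then show "norm (f (v + \<tau> j S) - f v) \<le>
          a + L * (1 / 2 * (norm (signed_sum n x S) + norm (signed_sum n x (sym_diff S {j}))))"
        using upper[of "v + \<tau> j S" v] by simp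
    qed
    also have "\<dots> = a + L * sign_average n (\<lambda>S. norm (signed_sum n x S))"
      using j sign_average_sym_diff[of "{j}" n "\<lambda>S. norm (signed_sum n x S)"]
      by (simp only: sign_average_scale sign_average_add sign_average_const) simp
    also have "\<dots> \<le> a + L * s" using avg L by (intro add_left_mono mult_left_mono)
    finally show ?thesis using s by simp
  qed
  have D_h: "2 *\<^sub>R D j u = h j (u + x j) - h j (u - x j)" if j: "j < n" for j u
  proof -
    let ?P = "Pow {..<n}"
    have "(\<Sum>S\<in>?P. sgn_at (sym_diff S {j}) j *\<^sub>R F u (sym_diff S {j})) = (\<Sum>S\<in>?P. sgn_at S j *\<^sub>R F u S)"
      using j sum_sym_diff[of "{j}" "{..<n}" "\<lambda>S. sgn_at S j *\<^sub>R F u S"] by simp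
    \<comment> \<open>Pair each sign pattern with the one flipped at \<open>j\<close>.\<close>
    then have "2 *\<^sub>R (\<Sum>S\<in>?P. sgn_at S j *\<^sub>R F u S)
        = (\<Sum>S\<in>?P. sgn_at S j *\<^sub>R F u S + sgn_at (sym_diff S {j}) j *\<^sub>R F u (sym_diff S {j}))"
      by (simp add: sum.distrib scaleR_2)
    also have "\<dots> = (\<Sum>S\<in>?P. f (u + x j + \<tau> j S) - f (u - x j + \<tau> j S))"
    proof (intro sum.cong refl)
      fix S
      have 1: "signed_sum n x S = sgn_at S j *\<^sub>R x j + \<tau> j S"
        "signed_sum n x (sym_diff S {j}) = - sgn_at S j *\<^sub>R x j + \<tau> j S"
        using j by (simp_all add: \<tau>_def signed_sum_sym_diff scaleR_2 flip: scaleR_scaleR)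
      show "sgn_at S j *\<^sub>R F u S + sgn_at (sym_diff S {j}) j *\<^sub>R F u (sym_diff S {j}) =
          f (u + x j + \<tau> j S) - f (u - x j + \<tau> j S)"
        unfolding F_def 1 by (auto simp: sgn_at_def algebra_simps)
    qed
    finally have eq: "2 *\<^sub>R (\<Sum>S\<in>?P. sgn_at S j *\<^sub>R F u S) = (\<Sum>S\<in>?P. f (u + x j + \<tau> j S) - f (u - x j + \<tau> j S))" .
    have "2 *\<^sub>R D j u = (2 *\<^sub>R (\<Sum>S\<in>?P. sgn_at S j *\<^sub>R F u S)) /\<^sub>R 2 ^ n"
      by (simp add: D_def walsh_coeff_def walsh_def)
    also have "\<dots> = h j (u + x j) - h j (u - x j)"
      unfolding eq h_def sum_subtractf scaleR_diff_right ..
    finally show ?thesis .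
  qed
  define J where "J = {j. j < n \<and> 2 * real k * norm (x j) = t}"
  define P where "P = {..<n} \<rightarrow>\<^sub>E {..<k}"
  define pt where "pt l = (\<Sum>i<n. (2 * real (l i) + 1) *\<^sub>R x i)" for l :: "nat \<Rightarrow> nat"
  have line: "real k * (4 * a) powr q \<le> real k powr q * (\<Sum>i<k. norm (2 *\<^sub>R D j (pt (l(j := i)))) powr q)"
    if j: "j \<in> J" for j l
  proof -
    have jn: "j < n" and jt: "2 * real k * norm (x j) = t" using j by (auto simp: J_def)
    define w where "w = (\<Sum>i\<in>{..<n} - {j}. (2 * real (l i) + 1) *\<^sub>R x i)"
    have pt: "pt (l(j := i)) = w + (2 * real i + 1) *\<^sub>R x j" for i
      unfolding pt_def w_def using jn by (subst sum.remove[of _ j]) (auto intro!: sum.cong)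
    have "2 *\<^sub>R D j (pt (l(j := i))) = h j (w + (2 * real (Suc i)) *\<^sub>R x j) - h j (w + (2 * real i) *\<^sub>R x j)" for i
      unfolding D_h[OF jn] pt by (simp add: algebra_simps scaleR_2)
    then have "(\<Sum>i<k. 2 *\<^sub>R D j (pt (l(j := i)))) = h j (w + (2 * real k) *\<^sub>R x j) - h j (w + (2 * real 0) *\<^sub>R x j)"
      by (simp only: sum_lessThan_telescope[of "\<lambda>i. h j (w + (2 * real i) *\<^sub>R x j)" k])
    then have tel: "h j (w + (2 * real k) *\<^sub>R x j) - h j w = (\<Sum>i<k. 2 *\<^sub>R D j (pt (l(j := i))))" by simp
    have "norm (h j (w + (2 * real k) *\<^sub>R x j) - h j w) \<le> (\<Sum>i<k. norm (2 *\<^sub>R D j (pt (l(j := i)))))"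
      unfolding tel by (rule norm_sum)
    moreover have "r \<le> norm (f (w + (2 * real k) *\<^sub>R x j) - f w)"
      using jt by (intro lower) simp
    moreover have "norm (f (w + (2 * real k) *\<^sub>R x j) - f w) \<le>
        norm (h j (w + (2 * real k) *\<^sub>R x j) - h j w) + 2 * a + 2 * a"
    proof -
      have "f (w + (2 * real k) *\<^sub>R x j) - f w = (h j (w + (2 * real k) *\<^sub>R x j) - h j w)
          - (h j (w + (2 * real k) *\<^sub>R x j) - f (w + (2 * real k) *\<^sub>R x j)) + (h j w - f w)" by simp
      also have "norm \<dots> \<le> norm (h j (w + (2 * real k) *\<^sub>R x j) - h j w)
          + norm (h j (w + (2 * real k) *\<^sub>R x j) - f (w + (2 * real k) *\<^sub>R x j)) + norm (h j w - f w)"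
        by (intro order_trans[OF norm_triangle_ineq] add_right_mono norm_triangle_ineq4)
      finally show ?thesis using h_close[OF jn, of "w + (2 * real k) *\<^sub>R x j"] h_close[OF jn, of w] by linarith
    qed
    ultimately have "4 * a \<le> (\<Sum>i<k. norm (2 *\<^sub>R D j (pt (l(j := i)))))" using r by linarith
    then have "(4 * a) powr q \<le> (\<Sum>i<k. norm (2 *\<^sub>R D j (pt (l(j := i))))) powr q"
      using a q by (intro powr_mono2) auto
    also have "\<dots> \<le> real (card {..<k}) powr (q - 1) * (\<Sum>i<k. norm (2 *\<^sub>R D j (pt (l(j := i)))) powr q)"
      using q by (intro sum_powr_le) auto
    finally have "real k * (4 * a) powr q \<le> real k * (real k powr (q - 1) * (\<Sum>i<k. norm (2 *\<^sub>R D j (pt (l(j := i)))) powr q))"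
      by (intro mult_left_mono) auto
    also have "\<dots> = real k powr q * (\<Sum>i<k. norm (2 *\<^sub>R D j (pt (l(j := i)))) powr q)"
      using k by (simp add: powr_diff)
    finally show ?thesis .
  qed
  have finJ: "finite J" by (simp add: J_def)
  have box: "real (card P) * (4 * a) powr q \<le> real k powr q * (\<Sum>l\<in>P. norm (2 *\<^sub>R D j (pt l)) powr q)"
    if j: "j \<in> J" for j
  proof -
    have jn: "j \<in> {..<n}" using j by (simp add: J_def)
    let ?P' = "({..<n} - {j}) \<rightarrow>\<^sub>E {..<k}"
    have "card P = k * card ?P'"
    proof -
      have "card P = (\<Sum>l\<in>P. 1)" by simp
      also have "\<dots> = k * card ?P'" unfolding P_def by (subst sum_PiE_coordinate[OF jn]) simp
      finally show ?thesis .
    qed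
    then have "real (card P) * (4 * a) powr q = (\<Sum>l\<in>?P'. real k * (4 * a) powr q)" by simp
    also have "\<dots> \<le> (\<Sum>l\<in>?P'. real k powr q * (\<Sum>i<k. norm (2 *\<^sub>R D j (pt (l(j := i)))) powr q))"
      by (intro sum_mono line j)
    also have "\<dots> = real k powr q * (\<Sum>l\<in>P. norm (2 *\<^sub>R D j (pt l)) powr q)"
      unfolding P_def by (subst sum_PiE_coordinate[OF jn]) (simp add: sum_distrib_left)
    finally show ?thesis .
  qed
  have "real (card J) * (real (card P) * (4 * a) powr q) = (\<Sum>j\<in>J. real (card P) * (4 * a) powr q)" by simp
  also have "\<dots> \<le> (\<Sum>j\<in>J. real k powr q * (\<Sum>l\<in>P. norm (2 *\<^sub>R D j (pt l)) powr q))"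
    by (intro sum_mono box)
  also have "\<dots> = real k powr q * (\<Sum>l\<in>P. \<Sum>j\<in>J. norm (2 *\<^sub>R D j (pt l)) powr q)"
    by (subst sum.swap) (simp add: sum_distrib_left)
  also have "\<dots> \<le> real k powr q * (\<Sum>l\<in>P. (4 * C * a) powr q)"
  proof (intro mult_left_mono sum_mono)
    fix l
    have "(\<Sum>j\<in>J. norm (2 *\<^sub>R D j (pt l)) powr q) \<le> (\<Sum>j<n. norm (2 *\<^sub>R D j (pt l)) powr q)"
      by (intro sum_mono2) (auto simp: J_def)
    also have "\<dots> = 2 powr q * (\<Sum>j<n. norm (D j (pt l)) powr q)"
      by (simp add: powr_mult sum_distrib_left)
    also have "\<dots> \<le> 2 powr q * (2 * C * a) powr q"
      using level_one by (intro mult_left_mono) auto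
    also have "\<dots> = (2 * (2 * C * a)) powr q" by (rule powr_mult[symmetric])
    also have "2 * (2 * C * a) = 4 * C * a" by simp
    finally show "(\<Sum>j\<in>J. norm (2 *\<^sub>R D j (pt l)) powr q) \<le> (4 * C * a) powr q" .
  qed simp
  also have "\<dots> = (real k * C) powr q * (real (card P) * (4 * a) powr q)"
  proof -
    have "(4 * C * a) powr q = C powr q * (4 * a) powr q"
      unfolding powr_mult[symmetric] by (simp only: mult_ac)
    then show ?thesis by (simp add: powr_mult[of "real k" C])
  qed
  finally have "real (card J) * (real (card P) * (4 * a) powr q) \<le> (real k * C) powr q * (real (card P) * (4 * a) powr q)" .
  moreover have "0 < real (card P) * (4 * a) powr q"
    using k a by (simp add: P_def card_PiE)
  ultimately show ?thesis unfolding J_def by (rule mult_right_le_imp_le)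
qed

section \<open>Cotype from vectors of equal norm\<close>

lemma signed_sum_scale: "signed_sum n (\<lambda>j. b *\<^sub>R x j) S = b *\<^sub>R signed_sum n x S"
  by (simp add: signed_sum_def scaleR_sum_right mult.commute)

text \<open>
  Normalise the \<open>q'\<close>-th moment of the signed sum to \<open>1\<close>. By the contraction principle and the
  hypothesis, at most \<open>(c l)\<^sup>-\<^sup>q\<close> of the vectors have norm \<open>\<ge> l\<close>, so the \<open>i\<close>-th largest norm is
  at most \<open>c\<^sup>-\<^sup>1 i\<^sup>-\<^sup>1\<^sup>/\<^sup>q\<close>, and the \<open>q'\<close>-th powers of these norms are summable for \<open>q' > q\<close>.
\<close>
lemma cotype_of_equal_norm_estimate:
  fixes c q q' :: real
  assumes q: "1 \<le> q" "q < q'" "2 \<le> q'" and c: "0 < c"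
    and eq: "\<And>n (x :: nat \<Rightarrow> 'a::banach) J. J \<subseteq> {..<n} \<Longrightarrow> (\<And>j. j \<in> J \<Longrightarrow> norm (x j) = 1) \<Longrightarrow>
        c powr q * real (card J) \<le> sign_average n (\<lambda>S. norm (signed_sum n x S) powr q)"
  shows "has_cotype TYPE('a) q'"
proof -
  define z where "z i = real i powr (- (q' / q))" for i :: nat
  have summ: "summable z" unfolding z_def using q by (subst summable_real_powr_iff) simp
  have z0: "0 \<le> z i" for i by (simp add: z_def)
  define Z where "Z = 1 + suminf z"
  have Z: "0 < Z" using suminf_nonneg[OF summ z0] by (simp add: Z_def)
  have "(\<Sum>j<n. norm (x j) powr q') \<le> (Z powr (1 / q') / c) powr q' *
      sign_average n (\<lambda>S. norm (signed_sum n x S) powr q')" for n and x :: "nat \<Rightarrow> 'a"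
  proof -
    define A where "A p = sign_average n (\<lambda>S. norm (signed_sum n x S) powr p)" for p
    have A0: "0 \<le> A p" for p by (auto simp: A_def sign_average_def intro!: sum_nonneg divide_nonneg_pos)
    define W where "W = A q' powr (1 / q')"
    have W: "0 \<le> W" "W powr q' = A q'" using q A0 by (auto simp: W_def powr_powr)
    have AW: "A q \<le> W powr q"
    proof -
      have "A q powr (q' / q) \<le> A q'"
        using sign_average_jensen[of "q' / q" "\<lambda>S. norm (signed_sum n x S) powr q" n] q
        by (simp add: A_def powr_powr)
      then have "(A q powr (q' / q)) powr (q / q') \<le> A q' powr (q / q')"
        using q by (intro powr_mono2) auto
      then show ?thesis using q A0 by (simp add: powr_powr W_def)
    qed
    have few: "l powr q * (c powr q * real (card J)) \<le> W powr q"
      if J: "J \<subseteq> {..<n}" and l: "0 < l" "\<And>j. j \<in> J \<Longrightarrow> l \<le> norm (x j)" for J l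
    proof -
      define b where "b j = (if j \<in> J then 1 / norm (x j) else 0)" for j
      have "c powr q * real (card J) \<le> sign_average n (\<lambda>S. norm (signed_sum n (\<lambda>j. b j *\<^sub>R x j) S) powr q)"
      proof (rule eq[OF J])
        show "norm (b j *\<^sub>R x j) = 1" if "j \<in> J" for j
          using that l(2)[OF that] l(1) by (auto simp: b_def)
      qed
      then have "l powr q * (c powr q * real (card J)) \<le>
          l powr q * sign_average n (\<lambda>S. norm (signed_sum n (\<lambda>j. b j *\<^sub>R x j) S) powr q)"
        by (intro mult_left_mono) auto
      also have "\<dots> = sign_average n (\<lambda>S. norm (signed_sum n (\<lambda>j. (l * b j) *\<^sub>R x j) S) powr q)"
        using l(1) signed_sum_scale[of n l "\<lambda>j. b j *\<^sub>R x j"]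
        by (simp add: powr_mult sign_average_scale)
      also have "\<dots> \<le> A q"
        unfolding A_def
      proof (rule contraction_principle[OF q(1)])
        show "\<bar>l * b j\<bar> \<le> 1" for j
        proof (cases "j \<in> J")
          case True
          then have "0 < norm (x j)" "l \<le> norm (x j)" using l by force+
          then show ?thesis using l(1) True by (simp add: b_def)
        qed (simp add: b_def)
      qed
      finally show ?thesis using AW by simp
    qed
    have sorted: "(\<Sum>j\<in>J. norm (x j) powr q') \<le> (W / c) powr q' * (\<Sum>i<Suc m. z i)"
      if "card J = m" "J \<subseteq> {..<n}" "\<And>j. j \<in> J \<Longrightarrow> x j \<noteq> 0" for J m
      using that
    proof (induction m arbitrary: J)
      case 0
      then have "J = {}" using finite_subset[of J "{..<n}"] by auto
      then show ?case by (simp add: z_def)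
    next
      case (Suc m)
      have fin: "finite J" using Suc.prems(2) finite_subset by blast
      have ne: "J \<noteq> {}" using Suc.prems(1) by auto
      \<comment> \<open>Removing the smallest vector first enumerates the norms in increasing order.\<close>
      obtain i where i: "i \<in> J" "\<And>j. j \<in> J \<Longrightarrow> norm (x i) \<le> norm (x j)"
        using ex_is_arg_min_if_finite[OF fin ne, of "\<lambda>j. norm (x j)"]
        by (auto simp: is_arg_min_linorder)
      have "norm (x i) powr q * (c powr q * real (Suc m)) \<le> W powr q"
        using few[OF Suc.prems(2), of "norm (x i)"] i Suc.prems by auto
      then have "norm (x i) powr q \<le> (W / c) powr q * real (Suc m) powr (- 1)"
      proof -
        have "norm (x i) powr q \<le> W powr q / (c powr q * real (Suc m))"
          using \<open>norm (x i) powr q * (c powr q * real (Suc m)) \<le> W powr q\<close> c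
          by (subst pos_le_divide_eq) auto
        also have "\<dots> = (W / c) powr q * real (Suc m) powr (- 1)"
          unfolding powr_divide powr_minus using W by (simp add: inverse_eq_divide del: of_nat_Suc)
        finally show ?thesis .
      qed
      then have "(norm (x i) powr q) powr (q' / q) \<le> ((W / c) powr q * real (Suc m) powr (- 1)) powr (q' / q)"
        using q by (intro powr_mono2) auto
      then have new: "norm (x i) powr q' \<le> (W / c) powr q' * z (Suc m)"
      proof -
        have "q * (q' / q) = q'" "- 1 * (q' / q) = - (q' / q)" using q by simp_all
        then show ?thesis
          using \<open>(norm (x i) powr q) powr (q' / q) \<le> _\<close> by (simp only: powr_mult powr_powr z_def)
      qed
      have "(\<Sum>j\<in>J - {i}. norm (x j) powr q') \<le> (W / c) powr q' * (\<Sum>i<Suc m. z i)"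
        using Suc.prems i(1) fin by (intro Suc.IH) auto
      then have "norm (x i) powr q' + (\<Sum>j\<in>J - {i}. norm (x j) powr q')
          \<le> (W / c) powr q' * z (Suc m) + (W / c) powr q' * (\<Sum>i<Suc m. z i)"
        by (rule add_mono[OF new])
      also have "\<dots> = (W / c) powr q' * (\<Sum>i<Suc (Suc m). z i)"
        by (simp only: sum.lessThan_Suc[of z "Suc m"] distrib_left add.commute)
      finally show ?case
        by (simp only: sum.remove[OF fin i(1)])
    qed
    define J where "J = {j. j < n \<and> x j \<noteq> 0}"
    have "(\<Sum>j<n. norm (x j) powr q') = (\<Sum>j\<in>J. norm (x j) powr q')"
      unfolding J_def by (intro sum.mono_neutral_right) auto
    also have "\<dots> \<le> (W / c) powr q' * (\<Sum>i<Suc (card J). z i)"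
      by (rule sorted[OF refl]) (auto simp: J_def)
    also have "\<dots> \<le> (W / c) powr q' * Z"
    proof (rule mult_left_mono)
      have "(\<Sum>i<Suc (card J). z i) \<le> suminf z"
        by (rule sum_le_suminf[OF summ]) (simp_all add: z0)
      then show "(\<Sum>i<Suc (card J). z i) \<le> Z" unfolding Z_def by linarith
    qed simp
    also have "\<dots> = (Z powr (1 / q') / c) powr q' * A q'"
    proof -
      have "(Z powr (1 / q')) powr q' = Z" using Z q by (simp add: powr_powr)
      then show ?thesis unfolding powr_divide W(2) by (simp add: mult.commute)
    qed
    finally show ?thesis unfolding A_def .
  qed
  then show ?thesis
    using q c Z unfolding has_cotype_iff by (intro conjI exI[of _ "Z powr (1 / q') / c"]) auto
qed

text \<open>
  If unit vectors violate the estimate for a tiny \<open>c\<close>, then their multiples of norm \<open>t / (2 k)\<close> satisfy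
  the moment hypothesis of \<open>lattice_estimate\<close> for all \<open>k \<ge> \<beta> c \<nu>\<close>, where \<open>\<nu>\<^sup>q\<close> is the number of
  vectors, whereas the conclusion requires \<open>\<nu> \<le> k C\<close>. Rounding to an integer costs at most \<open>1\<close>, and
  \<open>1 \<le> c \<nu>\<close> since a signed sum is on average at least as long as each of its terms. So \<open>c\<close> only has to
  beat \<open>C (\<beta> + 1)\<close>.
\<close>
lemma equal_norm_estimate_of_map:
  fixes f :: "'a::real_normed_vector \<Rightarrow> 'b::real_normed_vector"
  assumes coeff: "\<And>n (F :: nat set \<Rightarrow> 'b). (\<Sum>j<n. norm (walsh_coeff n F {j}) powr q)
        \<le> C powr q * sign_average n (\<lambda>S. norm (F S) powr q)"
    and C: "0 < C" and q: "1 \<le> q" and a: "0 < a" and L: "0 < L" and r: "8 * a \<le> r"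
    and upper: "\<And>u v. norm (f u - f v) \<le> a + L * norm (u - v)"
    and lower: "\<And>u v. norm (u - v) = t \<Longrightarrow> r \<le> norm (f u - f v)" and t: "0 < t"
  shows "\<exists>c>0. \<forall>n (x :: nat \<Rightarrow> 'a) J. J \<subseteq> {..<n} \<longrightarrow> (\<forall>j\<in>J. norm (x j) = 1) \<longrightarrow>
        c powr q * real (card J) \<le> sign_average n (\<lambda>S. norm (signed_sum n x S) powr q)"
proof -
  define \<beta> where "\<beta> = L * t / (2 * a)"
  have \<beta>: "0 < \<beta>" using L t a by (simp add: \<beta>_def)
  define c where "c = 1 / (2 * C * (\<beta> + 1))"
  have c: "0 < c" using C \<beta> by (simp add: c_def)
  have "c powr q * real (card J) \<le> sign_average n (\<lambda>S. norm (signed_sum n x S) powr q)"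
    if J: "J \<subseteq> {..<n}" "\<forall>j\<in>J. norm (x j) = 1" for n and x :: "nat \<Rightarrow> 'a" and J
  proof (rule ccontr)
    let ?A = "sign_average n (\<lambda>S. norm (signed_sum n x S) powr q)"
    assume "\<not> c powr q * real (card J) \<le> ?A"
    then have lt: "?A < c powr q * real (card J)" by simp
    have "0 \<le> ?A" by (auto simp: sign_average_def intro!: sum_nonneg divide_nonneg_pos)
    then have cJ: "0 < card J" using lt by (cases "card J = 0") auto
    define \<nu> where "\<nu> = real (card J) powr (1 / q)"
    have \<nu>: "0 < \<nu>" "\<nu> powr q = real (card J)" using cJ q by (auto simp: \<nu>_def powr_powr)
    have A: "?A \<le> (c * \<nu>) powr q" using lt c \<nu> by (simp add: powr_mult)
    obtain j where j: "j \<in> J" using cJ by (metis card.empty ex_in_conv less_irrefl)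
    have one: "1 \<le> c * \<nu>"
    proof -
      have "1 = norm (x j)" using J j by simp
      also have "\<dots> \<le> sign_average n (\<lambda>S. norm (signed_sum n x S))"
        using J j by (intro norm_le_average) auto
      also have "\<dots> \<le> c * \<nu>" using c \<nu> by (intro average_norm_le_moment[OF q _ A]) auto
      finally show ?thesis .
    qed
    define k where "k = nat \<lceil>\<beta> * (c * \<nu>)\<rceil>"
    have pos: "0 < \<beta> * (c * \<nu>)" using \<beta> c \<nu> by simp
    have k: "0 < k" "\<beta> * (c * \<nu>) \<le> real k" "real k \<le> \<beta> * (c * \<nu>) + 1"
      using pos by (auto simp: k_def)
    define b where "b = t / (2 * real k)"
    have b: "0 < b" using t k by (simp add: b_def)
    have "real (card {j. j < n \<and> 2 * real k * norm (b *\<^sub>R x j) = t}) \<le> (real k * C) powr q"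
    proof (rule lattice_estimate[OF coeff C q a _ r upper lower, where s = "b * (c * \<nu>)"])
      have "L * (b * (c * \<nu>)) = a * (\<beta> * (c * \<nu>)) / real k"
        using a k by (simp add: b_def \<beta>_def)
      also have "\<dots> \<le> a" using a k by (simp add: field_simps)
      finally show "L * (b * (c * \<nu>)) \<le> a" .
      have "sign_average n (\<lambda>S. norm (signed_sum n (\<lambda>j. b *\<^sub>R x j) S) powr q) = b powr q * ?A"
        using b by (simp add: signed_sum_scale powr_mult sign_average_scale)
      also have "\<dots> \<le> b powr q * (c * \<nu>) powr q" using A by (intro mult_left_mono) auto
      finally show "sign_average n (\<lambda>S. norm (signed_sum n (\<lambda>j. b *\<^sub>R x j) S) powr q) \<le> (b * (c * \<nu>)) powr q"
        using b c \<nu> by (simp add: powr_mult)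
    qed (use L b c \<nu> k in auto)
    moreover have "card J \<le> card {j. j < n \<and> 2 * real k * norm (b *\<^sub>R x j) = t}"
      using J k t by (intro card_mono) (auto simp: b_def)
    ultimately have "\<nu> powr q \<le> (real k * C) powr q" using \<nu> by simp
    then have "\<nu> \<le> real k * C"
      using powr_less_mono2[of q "real k * C" \<nu>] q C k \<nu> by (meson less_imp_le mult_nonneg_nonneg not_le of_nat_0_le_iff order_less_le_trans zero_less_one)
    also have "\<dots> \<le> (\<beta> * (c * \<nu>) + c * \<nu>) * C" using k one C by (intro mult_right_mono) auto
    also have "\<dots> = \<nu> * (c * (C * (\<beta> + 1)))" by (simp add: algebra_simps)
    also have "c * (C * (\<beta> + 1)) = 1 / 2"
      using C \<beta> by (simp add: c_def)
    finally show False using \<nu> by simp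
  qed
  then show ?thesis using c by blast
qed

section \<open>Maps with two scales\<close>

text \<open>
  Subdivide the segment from \<open>v\<close> to \<open>u\<close> into steps of length at most \<open>d\<close>.
\<close>
lemma large_scale_lipschitz:
  fixes f :: "'a::real_normed_vector \<Rightarrow> 'b::real_normed_vector"
  assumes d: "0 < d" and small: "\<And>u v. norm (u - v) \<le> d \<Longrightarrow> norm (f u - f v) \<le> a"
  shows "norm (f u - f v) \<le> a + a / d * norm (u - v)"
proof -
  have a: "0 \<le> a" using small[of 0 0] d by simp
  define m where "m = nat \<lceil>norm (u - v) / d\<rceil>"
  have m: "norm (u - v) / d \<le> real m" "real m \<le> norm (u - v) / d + 1"
    using d by (auto simp: m_def)
  show ?thesis
  proof (cases "m = 0")
    case True
    then have "norm (u - v) / d \<le> 0" using m by simp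
    then have "u = v" using d by (simp add: divide_le_0_iff)
    then show ?thesis using a by simp
  next
    case False
    define w where "w i = v + (real i / real m) *\<^sub>R (u - v)" for i
    have "norm (f (w (Suc i)) - f (w i)) \<le> a" for i
    proof (rule small)
      have "w (Suc i) - w i = (1 / real m) *\<^sub>R (u - v)"
        by (simp add: w_def add_divide_distrib scaleR_add_left)
      then have "norm (w (Suc i) - w i) = norm (u - v) / real m" by simp
      also have "\<dots> \<le> d" using m(1) False d by (simp add: field_simps)
      finally show "norm (w (Suc i) - w i) \<le> d" .
    qed
    then have "(\<Sum>i<m. norm (f (w (Suc i)) - f (w i))) \<le> (\<Sum>i<m. a)" by (intro sum_mono)
    moreover have "f u - f v = (\<Sum>i<m. f (w (Suc i)) - f (w i))"
      unfolding sum_lessThan_telescope[of "\<lambda>i. f (w i)"] using False by (simp add: w_def)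
    ultimately have "norm (f u - f v) \<le> real m * a"
      using norm_sum[of "\<lambda>i. f (w (Suc i)) - f (w i)" "{..<m}"] by simp
    also have "\<dots> \<le> (norm (u - v) / d + 1) * a" using m a by (intro mult_right_mono)
    finally show ?thesis by (simp add: algebra_simps)
  qed
qed

theorem cotype_transfer:
  fixes f :: "'a::banach \<Rightarrow> 'b::banach"
  assumes type: "has_nontrivial_type TYPE('b)" and cotype: "has_cotype TYPE('b) q"
    and d: "0 < d" and a: "0 < a" and t: "0 < t" and r: "8 * a \<le> r"
    and small: "\<And>u v. norm (u - v) \<le> d \<Longrightarrow> norm (f u - f v) \<le> a"
    and lower: "\<And>u v. norm (u - v) = t \<Longrightarrow> r \<le> norm (f u - f v)"
    and q': "q < q'"
  shows "has_cotype TYPE('a) q'"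
proof -
  have q: "2 \<le> q" using cotype by (simp add: has_cotype_def)
  obtain C where C: "0 < C" "\<And>n (F :: nat set \<Rightarrow> 'b).
    (\<Sum>j<n. norm (walsh_coeff n F {j}) powr q) \<le> C powr q * sign_average n (\<lambda>S. norm (F S) powr q)"
    using level_one_coefficients[OF type cotype] by blast
  have upper: "norm (f u - f v) \<le> a + a / d * norm (u - v)" for u v
    by (rule large_scale_lipschitz[OF d small])
  obtain c where c: "0 < c" "\<And>n (x :: nat \<Rightarrow> 'a) J. J \<subseteq> {..<n} \<Longrightarrow> (\<And>j. j \<in> J \<Longrightarrow> norm (x j) = 1) \<Longrightarrow>
        c powr q * real (card J) \<le> sign_average n (\<lambda>S. norm (signed_sum n x S) powr q)"
    using equal_norm_estimate_of_map[OF C(2,1) _ a _ r upper lower t] q a d by auto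
  show ?thesis
    by (rule cotype_of_equal_norm_estimate[OF _ q' _ c]) (use q q' in auto)
qed

text \<open>
  A coarse map is bounded on scale \<open>1\<close>, by some \<open>a\<close>, and a solvent map has arbitrarily large
  compression at suitable distances \<open>t\<close>, in particular at least \<open>8 a\<close>.
\<close>
lemma coarse_solvent_scale:
  fixes f :: "'a::real_normed_vector \<Rightarrow> 'b::real_normed_vector"
  assumes "coarse_map f" "solvent_map f"
  shows "\<exists>d>0. \<exists>a>0. \<exists>t>0. \<exists>r\<ge>8 * a. (\<forall>u v. norm (u - v) \<le> d \<longrightarrow> norm (f u - f v) \<le> a) \<and>
      (\<forall>u v. norm (u - v) = t \<longrightarrow> r \<le> norm (f u - f v))"
proof -
  have "expansion_modulus f 1 < \<infinity>" using assms(1) by (simp add: coarse_map_def)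
  then obtain b where b: "expansion_modulus f 1 < ereal b" using ereal_dense2 by blast
  have small: "norm (f u - f v) \<le> max 1 b" if "norm (u - v) \<le> 1" for u v
  proof -
    have "ereal (dist (f u) (f v)) \<le> expansion_modulus f 1"
      unfolding expansion_modulus_def using that by (intro Sup_upper) (auto simp: dist_norm)
    then have "ereal (dist (f u) (f v)) < ereal b" using b by (rule order_le_less_trans)
    then show ?thesis by (simp add: dist_norm)
  qed
  define N where "N = nat \<lceil>8 * max 1 b\<rceil>"
  have N: "8 * max 1 b \<le> real N" by (simp add: N_def of_nat_ceiling)
  obtain R where R: "0 < R" "\<And>u v. dist u v \<in> {R..R + real N} \<Longrightarrow> real N < dist (f u) (f v)"
    using assms(2) unfolding solvent_map_def by blast
  have "real N \<le> norm (f u - f v)" if "norm (u - v) = R" for u v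
    using R(2)[of u v] that by (simp add: dist_norm)
  then show ?thesis
    using small N R(1) by (intro exI[of _ 1] exI[of _ "max 1 b"] exI[of _ R] exI[of _ "real N"] conjI) auto
qed

text \<open>
  Here the large scale comes first: \<open>t\<close> and the lower bound \<open>r\<close> are given by \<open>f\<close>, and uniform continuity
  provides a scale on which \<open>f\<close> moves points by at most \<open>a = r / 8\<close>.
\<close>
lemma uniformly_continuous_uncollapsed_scale:
  fixes f :: "'a::real_normed_vector \<Rightarrow> 'b::real_normed_vector"
  assumes "uniformly_continuous_on UNIV f" "almost_uncollapsed f"
  shows "\<exists>d>0. \<exists>a>0. \<exists>t>0. \<exists>r\<ge>8 * a. (\<forall>u v. norm (u - v) \<le> d \<longrightarrow> norm (f u - f v) \<le> a) \<and>
      (\<forall>u v. norm (u - v) = t \<longrightarrow> r \<le> norm (f u - f v))"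
proof -
  obtain t where t: "0 < t" "0 < exact_compression_modulus f t"
    using assms(2) by (auto simp: almost_uncollapsed_def)
  then obtain r where r: "0 < ereal r" "ereal r < exact_compression_modulus f t"
    using ereal_dense2 by blast
  have lower: "r \<le> norm (f u - f v)" if "norm (u - v) = t" for u v
  proof -
    have "exact_compression_modulus f t \<le> ereal (dist (f u) (f v))"
      unfolding exact_compression_modulus_def using that by (intro Inf_lower) (auto simp: dist_norm)
    then have "ereal r < ereal (dist (f u) (f v))" using r(2) by (rule order_less_le_trans[rotated])
    then show ?thesis by (simp add: dist_norm)
  qed
  have "0 < r / 8" using r(1) by simp
  then obtain d where d: "0 < d" "\<And>u v. dist v u < d \<Longrightarrow> dist (f v) (f u) < r / 8"
    using assms(1) unfolding uniformly_continuous_on_def by (metis UNIV_I)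
  have "norm (f u - f v) \<le> r / 8" if "norm (u - v) \<le> d / 2" for u v
    using d(2)[of u v] that d(1) by (simp add: dist_norm)
  then show ?thesis
    using lower t(1) d(1) \<open>0 < r / 8\<close>
    by (intro exI[of _ "d / 2"] exI[of _ "r / 8"] exI[of _ t] exI[of _ r] conjI) auto
qed

theorem theorem1p3:
  assumes "has_nontrivial_type TYPE('b::banach)"
    and "(\<exists>f :: 'a::banach \<Rightarrow> 'b. coarse_map f \<and> solvent_map f) \<or>
         (\<exists>f :: 'a \<Rightarrow> 'b. uniformly_continuous_on UNIV f \<and> almost_uncollapsed f)"
  shows "cotype_index TYPE('a) \<le> cotype_index TYPE('b)"
proof -
  have "\<exists>(f :: 'a \<Rightarrow> 'b) d a t r. 0 < d \<and> 0 < a \<and> 0 < t \<and> 8 * a \<le> r \<and>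
      (\<forall>u v. norm (u - v) \<le> d \<longrightarrow> norm (f u - f v) \<le> a) \<and>
      (\<forall>u v. norm (u - v) = t \<longrightarrow> r \<le> norm (f u - f v))"
    using assms(2)
  proof
    assume "\<exists>f :: 'a \<Rightarrow> 'b. coarse_map f \<and> solvent_map f"
    then obtain f :: "'a \<Rightarrow> 'b" where "coarse_map f" "solvent_map f" by blast
    from coarse_solvent_scale[OF this] show ?thesis by blast
  next
    assume "\<exists>f :: 'a \<Rightarrow> 'b. uniformly_continuous_on UNIV f \<and> almost_uncollapsed f"
    then obtain f :: "'a \<Rightarrow> 'b" where "uniformly_continuous_on UNIV f" "almost_uncollapsed f" by blast
    from uniformly_continuous_uncollapsed_scale[OF this] show ?thesis by blast
  qed
  then obtain f :: "'a \<Rightarrow> 'b" and d a t r where f: "0 < d" "0 < a" "0 < t" "8 * a \<le> r"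
      "\<And>u v. norm (u - v) \<le> d \<Longrightarrow> norm (f u - f v) \<le> a"
      "\<And>u v. norm (u - v) = t \<Longrightarrow> r \<le> norm (f u - f v)"
    by blast
  show ?thesis
    unfolding cotype_index_def[of "TYPE('b)"]
  proof (rule Inf_greatest)
    fix z assume "z \<in> {ereal q |q. has_cotype TYPE('b) q}"
    then obtain q where z: "z = ereal q" and q: "has_cotype TYPE('b) q" by blast
    show "cotype_index TYPE('a) \<le> z"
    proof (rule ccontr)
      assume "\<not> cotype_index TYPE('a) \<le> z"
      then obtain q' where q': "ereal q < ereal q'" "ereal q' < cotype_index TYPE('a)"
        using z ereal_dense2 by (metis not_le)
      have "has_cotype TYPE('a) q'"
        using cotype_transfer[OF assms(1) q f] q'(1) by simp
      then have "cotype_index TYPE('a) \<le> ereal q'"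
        unfolding cotype_index_def by (intro Inf_lower) blast
      then show False using q'(2) by simp
    qed
  qed
qed

end
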